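(* For the pendulum, let $I$ be the action and $J$ the imaginary action as functions of the energy $h$, and let $q$, as a function of $J$, be the power series in $J$ (with $q=J/32+O(J^2)$) that equals $$q=\exp\left(-2\pi\frac{\partial I}{\partial J}\right)$$ for small $J>0$. Then its inverse function $J(q)$ is $$J(q)=-16\,q\,\frac{\partial\vartheta_4/\partial q}{\vartheta_4^3}=8q\frac{\partial}{\partial q}\frac1{\vartheta_4^2}=32\left(q+6q^2+24q^3+76q^4+\cdots\right),\qquad \vartheta_4=\vartheta_4(q)=\sum_{n\in\mathbb Z}(-1)^nq^{n^2}.$$
   Context: The pendulum in dimensionless units has Hamiltonian $H=\frac12p_\theta^2+\cos\theta-1=\frac12p_\theta^2-2\sin^2\frac\theta2$; the unstable equilibrium $\theta=0$ has energy $h=0$. For $h>0$ the action and imaginary action are $$I(h)=\frac4{\pi k}E(k),\qquad J(h)=\frac8{\pi k}\bigl(K(k')-E(k')\bigr),\qquad k^2=\frac2{2+h},\quad k'^2=1-k^2=\frac h{2+h},$$ where $K(k)$ and $E(k)$ are the complete elliptic integrals of the first and second kind with modulus $k$. $J(h)=h-\frac1{16}h^2+\cdots$ extends analytically to a neighbourhood of $h=0$ and is invertible there, and $\partial I/\partial J=(\partial I/\partial h)/(\partial J/\partial h)$ denotes the derivative of the action regarded as a function of the imaginary action. *)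

theory Defs
  imports "HOL-Complex_Analysis.Complex_Analysis"
begin

text \<open>Complete elliptic integrals of the first and second kind, as functions of the
  modulus \<open>k\<close> (not of the parameter \<open>k\<^sup>2\<close>).\<close>

definition ellipticK :: "real \<Rightarrow> real" where
  "ellipticK k = integral {0..pi/2} (\<lambda>t. 1 / sqrt (1 - k\<^sup>2 * (sin t)\<^sup>2))"

definition ellipticE :: "real \<Rightarrow> real" where
  "ellipticE k = integral {0..pi/2} (\<lambda>t. sqrt (1 - k\<^sup>2 * (sin t)\<^sup>2))"

definition pend_modulus :: "real \<Rightarrow> real" where
  "pend_modulus h = sqrt (2 / (2 + h))"

definition pend_comodulus :: "real \<Rightarrow> real" where
  "pend_comodulus h = sqrt (1 - (pend_modulus h)\<^sup>2)"

text \<open>Action and imaginary action of the pendulum with Hamiltonian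
  \<open>p\<^sup>2 / 2 + cos \<theta> - 1\<close> at energy \<open>h\<close>; only their values for \<open>h > 0\<close> are meaningful.\<close>

definition pend_I :: "real \<Rightarrow> real" where
  "pend_I h = 4 / (pi * pend_modulus h) * ellipticE (pend_modulus h)"

definition pend_J :: "real \<Rightarrow> real" where
  "pend_J h = 8 / (pi * pend_modulus h) *
     (ellipticK (pend_comodulus h) - ellipticE (pend_comodulus h))"

text \<open>The derivative of \<open>I\<close> regarded as a function of \<open>J\<close>, parametrized by the energy.\<close>

definition pend_dI_dJ :: "real \<Rightarrow> real" where
  "pend_dI_dJ h = deriv pend_I h / deriv pend_J h"

text \<open>\<open>Q\<close> is a convergent power series in \<open>J\<close> that represents \<open>exp (- 2 \<pi> \<partial>I/\<partial>J)\<close> for all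
  sufficiently small \<open>J > 0\<close>.\<close>

definition is_q_series :: "complex fps \<Rightarrow> bool" where
  "is_q_series Q \<longleftrightarrow> fps_conv_radius Q > 0 \<and>
     (\<exists>\<epsilon>>0. \<forall>h>0. 0 < pend_J h \<and> pend_J h < \<epsilon> \<longrightarrow>
        eval_fps Q (complex_of_real (pend_J h)) =
          complex_of_real (exp (- 2 * pi * pend_dI_dJ h)))"

text \<open>\<open>g\<close> is the inverse function of \<open>f\<close> near the fixed point \<open>0\<close>.\<close>

definition inverse_near_0 :: "(complex \<Rightarrow> complex) \<Rightarrow> (complex \<Rightarrow> complex) \<Rightarrow> bool" where
  "inverse_near_0 f g \<longleftrightarrow> f 0 = 0 \<and> g 0 = 0 \<and> isCont f 0 \<and> isCont g 0 \<and>
     (\<forall>\<^sub>F z in nhds 0. g (f z) = z) \<and> (\<forall>\<^sub>F w in nhds 0. f (g w) = w)"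

text \<open>The theta constant as a function of the nome; meaningful for \<open>norm q < 1\<close>.\<close>

definition theta4 :: "complex \<Rightarrow> complex" where
  "theta4 q = (\<Sum>\<^sub>\<infinity>n\<in>(UNIV :: int set). (-1) powi n * q ^ nat (n\<^sup>2))"

end

theory Submission
  imports Defs "HOL-Real_Asymp.Real_Asymp"
begin

text \<open>
  Let \<open>a = \<theta>\<^sub>3\<^sup>2\<close> and \<open>b = \<theta>\<^sub>4\<^sup>2\<close> as functions of the nome \<open>q\<close> in the interval \<open>(0, 1)\<close>, where
  \<open>\<theta>\<^sub>3(q) = \<theta>\<^sub>4(-q)\<close>. The duplication formulas \<open>theta_sum_squares\<close> and \<open>theta_mult\<close> say that
  replacing \<open>q\<close> by \<open>q\<^sup>2\<close> performs one step of the arithmetic-geometric mean on \<open>(a, b)\<close>. The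
  integrals

    \<open>G(a, b) = \<integral> dx / sqrt (a\<^sup>2 cos\<^sup>2 x + b\<^sup>2 sin\<^sup>2 x)\<close> and
    \<open>S(a, b) = \<integral> sin\<^sup>2 x dx / sqrt (a\<^sup>2 cos\<^sup>2 x + b\<^sup>2 sin\<^sup>2 x)\<close> over \<open>[0, pi/2]\<close>

  transform under such a step by Landen's substitution (\<open>gauss_int_agm\<close>, \<open>gauss_sin_int_agm\<close>).
  A function of \<open>q\<close> that is invariant under \<open>q \<mapsto> q\<^sup>2\<close> and has a limit at \<open>0\<close> is constant
  (\<open>square_invariant_eq_limit\<close>). Applied to four suitable invariants this gives, with \<open>'\<close> denoting
  the derivative with respect to \<open>q\<close>,

    \<open>G(a, b) = pi / 2\<close>, \<open>G(a, sqrt (a\<^sup>2 - b\<^sup>2)) = - ln q / 2\<close>,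
    \<open>2 q (ln (a / b))' = a\<^sup>2 - b\<^sup>2\<close> and \<open>(a\<^sup>2 - b\<^sup>2) S(a, b) = - pi q b' / b\<close>.

  On the other hand, for the pendulum \<open>J\<close>, \<open>dI / dh\<close> and \<open>dJ / dh\<close> are multiples of \<open>S\<close> and \<open>G\<close>
  (\<open>pend_J_eq\<close>, \<open>pend_I_deriv\<close>, \<open>pend_J_deriv\<close>), and by homogeneity their arguments become the ones
  above at the energy \<open>h = 2 (a\<^sup>2 - b\<^sup>2) / b\<^sup>2\<close>. Hence at this energy \<open>exp (- 2 pi dI / dJ) = q\<close> and
  \<open>J = - 8 q b' / b\<^sup>2 = - 16 q \<theta>\<^sub>4' / \<theta>\<^sub>4\<^sup>3\<close>.

  The right-hand side is holomorphic near \<open>0\<close> with derivative \<open>32\<close> there, so it has a holomorphic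
  local inverse, whose power series is the required one: every small \<open>h > 0\<close> is of the form above by
  continuity. It is the only such series by the identity theorem.
\<close>

section \<open>The theta constant as a power series, and its duplication formulas\<close>

lemma theta_terms_abs_summable:
  fixes q :: complex
  assumes "norm q < 1"
  shows "(\<lambda>n::int. norm ((-1) powi n * q ^ nat (n\<^sup>2))) summable_on UNIV"
proof -
  define f where "f = (\<lambda>n::int. norm ((-1) powi n * q ^ nat (n\<^sup>2)))"
  have bound: "f n \<le> norm q ^ nat \<bar>n\<bar>" for n
  proof -
    have "\<bar>n\<bar> \<le> n\<^sup>2"
      using self_le_power[of "\<bar>n\<bar>" 2] by (cases "n = 0") auto
    then have "nat \<bar>n\<bar> \<le> nat (n\<^sup>2)" by simp
    then have "norm q ^ nat (n\<^sup>2) \<le> norm q ^ nat \<bar>n\<bar>"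
      using assms by (intro power_decreasing) auto
    then show ?thesis by (simp add: f_def norm_mult norm_power norm_power_int)
  qed
  have geo: "(\<lambda>k::nat. norm q ^ k) summable_on UNIV"
    using assms by (intro norm_summable_imp_summable_on) (auto intro: summable_geometric)
  have "(\<lambda>n::int. norm q ^ nat \<bar>n\<bar>) summable_on range int"
    using geo by (subst summable_on_reindex) (auto simp: o_def)
  moreover have "(\<lambda>n::int. norm q ^ nat \<bar>n\<bar>) summable_on range (\<lambda>k. - int k)"
    using geo by (subst summable_on_reindex) (auto simp: o_def inj_on_def)
  ultimately have "(\<lambda>n::int. norm q ^ nat \<bar>n\<bar>) summable_on (range int \<union> range (\<lambda>k. - int k))"
    by (rule summable_on_union)
  moreover have "range int \<union> range (\<lambda>k. - int k) = UNIV"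
    by (metis (no_types, lifting) UNIV_eq_I UnI1 UnI2 int_cases2 rangeI)
  ultimately have "(\<lambda>n::int. norm q ^ nat \<bar>n\<bar>) summable_on UNIV" by simp
  then have "f summable_on UNIV"
    by (rule summable_on_comparison_test) (use bound in \<open>auto simp: f_def\<close>)
  then show ?thesis unfolding f_def .
qed

text \<open>An integer and its square have the same parity, so the sign of a theta term only depends on
  the exponent of \<open>q\<close>. This is what makes \<open>theta4 (- q)\<close> the theta constant
  \<open>\<theta>\<^sub>3(q) = \<Sum> q\<^bsup>n\<^sup>2\<^esup>\<close>.\<close>

lemma neg_one_powi_square: "(-1 :: 'a :: field) powi n = (-1) ^ nat (n\<^sup>2)"
proof -
  have "even (nat (n\<^sup>2)) = even n" by (subst even_nat_iff) auto
  then show ?thesis by (cases "even n") (auto simp: power_int_minus_left minus_one_power_iff)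
qed

lemma theta4_has_sum:
  assumes "norm q < 1"
  shows "((\<lambda>n::int. (-1) powi n * q ^ nat (n\<^sup>2)) has_sum theta4 q) UNIV"
  unfolding theta4_def
  by (rule has_sum_infsum[OF Infinite_Sum.abs_summable_summable[OF theta_terms_abs_summable[OF assms]]])

definition theta4_fps :: "complex fps" where
  "theta4_fps = Abs_fps (\<lambda>k. (-1) ^ k * of_nat (card {n::int. n\<^sup>2 = int k}))"

lemma finite_int_sqrt: "finite {n::int. n\<^sup>2 = int k}"
proof (rule finite_subset)
  show "{n::int. n\<^sup>2 = int k} \<subseteq> {- int k..int k}"
  proof
    fix n :: int assume "n \<in> {n. n\<^sup>2 = int k}"
    then have "n\<^sup>2 = int k" by simp
    moreover have "\<bar>n\<bar> \<le> n\<^sup>2"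
      using self_le_power[of "\<bar>n\<bar>" 2] by (cases "n = 0") auto
    ultimately have "\<bar>n\<bar> \<le> int k" by simp
    then show "n \<in> {- int k..int k}" by auto
  qed
qed auto

lemma theta4_fps_sums:
  assumes "norm q < 1"
  shows "(\<lambda>k. fps_nth theta4_fps k * q ^ k) sums theta4 q"
proof -
  let ?g = "\<lambda>n::int. (-1) powi n * q ^ nat (n\<^sup>2)"
  have "(?g has_sum theta4 q) UNIV"
    by (rule theta4_has_sum[OF assms])
  then have "((\<lambda>(k, n). ?g n) has_sum theta4 q) (SIGMA k:UNIV. {n::int. n\<^sup>2 = int k})"
    by (subst has_sum_reindex_bij_witness[where j = snd and i = "\<lambda>n. (nat (n\<^sup>2), n)"
          and T = UNIV and h = ?g]) auto
  then have "((\<lambda>k. fps_nth theta4_fps k * q ^ k) has_sum theta4 q) UNIV"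
  proof (rule has_sum_Sigma')
    fix k :: nat
    have "sum (\<lambda>n. ?g n) {n::int. n\<^sup>2 = int k} = (\<Sum>n\<in>{n::int. n\<^sup>2 = int k}. (-1) ^ k * q ^ k)"
      by (intro sum.cong) (auto simp: neg_one_powi_square)
    then have "sum (\<lambda>n. ?g n) {n::int. n\<^sup>2 = int k} = fps_nth theta4_fps k * q ^ k"
      by (simp add: theta4_fps_def)
    then show "((\<lambda>n. case (k, n) of (k, n) \<Rightarrow> ?g n) has_sum fps_nth theta4_fps k * q ^ k)
        {n::int. n\<^sup>2 = int k}"
      using has_sum_finite[OF finite_int_sqrt, of ?g k] by simp
  qed
  then show ?thesis by (rule has_sum_imp_sums)
qed

lemma theta4_fps_radius: "fps_conv_radius theta4_fps \<ge> 1"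
  unfolding fps_conv_radius_def one_ereal_def
proof (rule conv_radius_geI_ex')
  fix r :: real assume "0 < r" "ereal r < ereal 1"
  then show "summable (\<lambda>n. fps_nth theta4_fps n * of_real r ^ n)"
    using theta4_fps_sums[of "of_real r"] by (auto simp: sums_iff)
qed

lemma eval_theta4_fps: "norm q < 1 \<Longrightarrow> eval_fps theta4_fps q = theta4 q"
  using theta4_fps_sums[of q] by (simp add: eval_fps_def sums_iff)

lemma theta4_holomorphic: "theta4 holomorphic_on ball 0 1"
proof -
  have "eval_fps theta4_fps holomorphic_on ball 0 1"
  proof (intro holomorphic_on_eval_fps subsetI)
    fix z :: complex assume "z \<in> ball 0 1"
    then have "ereal (norm z) < 1" by simp
    also note theta4_fps_radius
    finally show "z \<in> eball 0 (fps_conv_radius theta4_fps)" by (simp add: in_eball_iff)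
  qed
  then show ?thesis
    by (rule holomorphic_transform) (simp add: eval_theta4_fps)
qed

lemma theta4_has_fps_expansion: "theta4 has_fps_expansion theta4_fps"
proof (rule has_fps_expansionI)
  have "eventually (\<lambda>q::complex. q \<in> ball 0 1) (nhds 0)"
    by (intro eventually_nhds_in_open) auto
  then show "\<forall>\<^sub>F u in nhds 0. (\<lambda>n. fps_nth theta4_fps n * u ^ n) sums theta4 u"
    by eventually_elim (auto intro: theta4_fps_sums)
qed

lemma theta4_fps_nth:
  "fps_nth theta4_fps 0 = 1" "fps_nth theta4_fps (Suc 0) = -2" "fps_nth theta4_fps 2 = 0"
  "fps_nth theta4_fps 3 = 0" "fps_nth theta4_fps 4 = 2"
proof -
  have nonsq: "{n::int. n\<^sup>2 = int k} = {}" if "k = 2 \<or> k = 3" for k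
  proof -
    have False if "n\<^sup>2 = int k" for n :: int
    proof -
      have "\<bar>n\<bar>\<^sup>2 < 2\<^sup>2" "1\<^sup>2 < \<bar>n\<bar>\<^sup>2" using that \<open>k = 2 \<or> k = 3\<close> by auto
      then have "\<bar>n\<bar> < 2" "1 < \<bar>n\<bar>"
        by (meson power2_less_imp_less abs_ge_zero zero_le_numeral zero_le_one)+
      then show False by simp
    qed
    then show ?thesis by auto
  qed
  have "n\<^sup>2 = 4 \<longleftrightarrow> n = 2 \<or> n = -2" for n :: int
    using power2_eq_iff[of n 2] by simp
  then have "{n::int. n\<^sup>2 = 4} = {2, -2}" by auto
  then show "fps_nth theta4_fps 4 = 2" by (simp add: theta4_fps_def)
  have "{n::int. n\<^sup>2 = 1} = {1, -1}" by (auto simp: power2_eq_1_iff)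
  then show "fps_nth theta4_fps (Suc 0) = -2" by (simp add: theta4_fps_def)
  show "fps_nth theta4_fps 0 = 1" by (simp add: theta4_fps_def)
  show "fps_nth theta4_fps 2 = 0" "fps_nth theta4_fps 3 = 0"
    using nonsq[of 2] nonsq[of 3] by (simp_all add: theta4_fps_def)
qed

lemma theta4_0: "theta4 0 = 1"
  using eval_theta4_fps[of 0] by (simp add: eval_fps_at_0 theta4_fps_nth)

lemma deriv_theta4_0: "deriv theta4 0 = -2"
  using fps_nth_fps_expansion[OF theta4_has_fps_expansion, of 1] by (simp add: theta4_fps_nth)


lemma has_sum_mult_UNIV:
  fixes f g :: "'a \<Rightarrow> complex"
  assumes f: "(f has_sum x) UNIV" "(\<lambda>a. norm (f a)) summable_on UNIV"
    and g: "(g has_sum y) UNIV" "(\<lambda>a. norm (g a)) summable_on UNIV"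
  shows "((\<lambda>(a, b). f a * g b) has_sum x * y) UNIV"
proof -
  have "(\<lambda>p. norm (case p of (a, b) \<Rightarrow> f a * g b)) summable_on (UNIV \<times> UNIV)"
  proof (subst Infinite_Sum.abs_summable_on_Sigma_iff, intro conjI ballI)
    fix a :: 'a
    show "(\<lambda>b. norm (case (a, b) of (a, b) \<Rightarrow> f a * g b)) summable_on UNIV"
      using summable_on_cmult_right[OF g(2), of "norm (f a)"] by (simp add: norm_mult)
  next
    have "(\<lambda>a. norm (f a) * (\<Sum>\<^sub>\<infinity>b. norm (g b))) summable_on UNIV"
      by (rule summable_on_cmult_left[OF f(2)])
    then show "(\<lambda>a. norm (\<Sum>\<^sub>\<infinity>b. norm (case (a, b) of (a, b) \<Rightarrow> f a * g b))) summable_on UNIV"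
      by (simp add: norm_mult infsum_cmult_right' infsum_nonneg)
  qed
  then have s: "(\<lambda>(a, b). f a * g b) summable_on (UNIV \<times> UNIV)"
    by (rule Infinite_Sum.abs_summable_summable)
  have "infsum (\<lambda>(a, b). f a * g b) (UNIV \<times> UNIV) = (\<Sum>\<^sub>\<infinity>a. \<Sum>\<^sub>\<infinity>b. f a * g b)"
    using infsum_Sigma_banach[OF s] by simp
  also have "\<dots> = x * y"
    using infsumI[OF f(1)] infsumI[OF g(1)] by (simp add: infsum_cmult_right' infsum_cmult_left')
  finally show ?thesis
    using has_sum_infsum[OF s] by simp
qed

text \<open>The lattice of pairs \<open>(m, n)\<close> with \<open>m + n\<close> even is parametrized by
  \<open>m = a + b\<close>, \<open>n = a - b\<close>. Because \<open>m\<^sup>2 + n\<^sup>2 = 2 (a\<^sup>2 + b\<^sup>2)\<close>, this change of variables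
  is what turns products of theta series in \<open>q\<close> into theta series in \<open>q\<^sup>2\<close>.\<close>

lemma has_sum_even_lattice:
  fixes f :: "int \<times> int \<Rightarrow> complex"
  assumes "(f has_sum s) UNIV" and odd: "\<And>m n. odd (m + n) \<Longrightarrow> f (m, n) = 0"
  shows "((\<lambda>(a, b). f (a + b, a - b)) has_sum s) UNIV"
proof -
  have "(f has_sum s) {(m, n). even (m + n)}"
    using assms(1) by (rule has_sum_cong_neutral[THEN iffD1, rotated -1]) (use odd in auto)
  then show ?thesis
    by (rule has_sum_reindex_bij_witness[where i = "\<lambda>(m, n). ((m + n) div 2, (m - n) div 2)"
          and j = "\<lambda>(a, b). (a + b, a - b)", THEN iffD2, rotated -1])
       (auto, presburger+)
qed

lemma theta3_terms: "(-1) powi n * (- q) ^ nat (n\<^sup>2) = (q :: 'a :: field) ^ nat (n\<^sup>2)"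
proof -
  have "(- q) ^ nat (n\<^sup>2) = (-1) ^ nat (n\<^sup>2) * q ^ nat (n\<^sup>2)"
    by (rule power_minus)
  then show ?thesis
    by (simp add: neg_one_powi_square flip: power_mult_distrib mult.assoc)
qed

lemma power_even_lattice:
  "(q::complex) ^ nat ((a + b)\<^sup>2) * q ^ nat ((a - b)\<^sup>2) = (q\<^sup>2) ^ nat (a\<^sup>2) * (q\<^sup>2) ^ nat (b\<^sup>2)"
proof -
  have "nat ((a + b)\<^sup>2) + nat ((a - b)\<^sup>2) = 2 * nat (a\<^sup>2) + 2 * nat (b\<^sup>2)"
    by (rule of_nat_eq_iff[where 'a = int, THEN iffD1]) (simp, simp add: power2_eq_square algebra_simps)
  then show ?thesis by (simp flip: power_add power_mult)
qed

text \<open>Both sides are sums over \<open>\<int> \<times> \<int>\<close> in which the pairs with odd \<open>m + n\<close> cancel: in the sum of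
  squares through the factor \<open>1 + (-1)\<^bsup>m + n\<^esup>\<close>, in the product after symmetrizing in
  \<open>m\<close> and \<open>n\<close>, which produces the factor \<open>(-1)\<^sup>m + (-1)\<^sup>n\<close>. With \<open>a = \<theta>\<^sub>3\<^sup>2\<close> and \<open>b = \<theta>\<^sub>4\<^sup>2\<close>
  the two identities say that passing from \<open>q\<close> to \<open>q\<^sup>2\<close> replaces \<open>(a, b)\<close> by its arithmetic and
  geometric mean.\<close>

lemma
  fixes q :: complex
  assumes q: "norm q < 1"
  shows theta_sum_squares: "theta4 (-q) ^ 2 + theta4 q ^ 2 = 2 * theta4 (- q\<^sup>2) ^ 2"
    and theta_mult: "theta4 (-q) * theta4 q = theta4 (q\<^sup>2) ^ 2"
proof -
  define c where "c = (\<lambda>n::int. (-1::complex) powi n)"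
  define e where "e = (\<lambda>q n. (q::complex) ^ nat (n\<^sup>2))"
  have q2: "norm (q\<^sup>2) < 1"
    using q by (simp add: norm_power power_less_one_iff)
  have t4: "((\<lambda>n. c n * e p n) has_sum theta4 p) UNIV" "(\<lambda>n. norm (c n * e p n)) summable_on UNIV"
    if "norm p < 1" for p
    using theta4_has_sum[OF that] theta_terms_abs_summable[OF that] by (simp_all add: c_def e_def)
  have t3: "(e p has_sum theta4 (-p)) UNIV" "(\<lambda>n. norm (e p n)) summable_on UNIV"
    if "norm p < 1" for p
    using theta4_has_sum[of "-p"] theta_terms_abs_summable[of "-p"] that
    by (simp_all add: theta3_terms e_def)
  have c_add: "c (m + n) = c m * c n" for m n
    by (simp add: c_def power_int_add)
  have c_even: "c n = 1" if "even n" for n using that by (simp add: c_def power_int_minus_left)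
  have c_odd: "c n = -1" if "odd n" for n using that by (simp add: c_def power_int_minus_left)
  have e_lat: "e q (a + b) * e q (a - b) = e (q\<^sup>2) a * e (q\<^sup>2) b" for a b
    unfolding e_def by (rule power_even_lattice)

  have "((\<lambda>(m, n). (e q m * e q n)) has_sum theta4 (-q) ^ 2) UNIV"
    using has_sum_mult_UNIV[OF t3 t3] q by (simp add: power2_eq_square)
  moreover have "((\<lambda>(m, n). (c m * e q m) * (c n * e q n)) has_sum theta4 q ^ 2) UNIV"
    using has_sum_mult_UNIV[OF t4 t4] q by (simp add: power2_eq_square)
  ultimately have "((\<lambda>p. (case p of (m, n) \<Rightarrow> e q m * e q n) + (case p of (m, n) \<Rightarrow> (c m * e q m) * (c n * e q n)))
      has_sum theta4 (-q) ^ 2 + theta4 q ^ 2) UNIV"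
    by (rule has_sum_add)
  then have "((\<lambda>(m, n). (1 + c (m + n)) * (e q m * e q n)) has_sum theta4 (-q) ^ 2 + theta4 q ^ 2) UNIV"
    by (simp add: case_prod_unfold c_add algebra_simps)
  then have "((\<lambda>(a, b). 2 * (e (q\<^sup>2) a * e (q\<^sup>2) b)) has_sum theta4 (-q) ^ 2 + theta4 q ^ 2) UNIV"
    by (drule_tac has_sum_even_lattice) (auto simp: c_odd c_even e_lat)
  moreover have "((\<lambda>(a, b). 2 * (e (q\<^sup>2) a * e (q\<^sup>2) b)) has_sum 2 * theta4 (- q\<^sup>2) ^ 2) UNIV"
    using has_sum_cmult_right[OF has_sum_mult_UNIV[OF t3 t3], OF q2 q2 q2 q2, of 2]
    by (simp add: power2_eq_square case_prod_unfold)
  ultimately show "theta4 (-q) ^ 2 + theta4 q ^ 2 = 2 * theta4 (- q\<^sup>2) ^ 2"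
    by (rule has_sum_unique)

  \<comment> \<open>The product is symmetrized, so that the odd pairs drop out.\<close>
  have mixed: "((\<lambda>(m, n). e q m * (c n * e q n)) has_sum theta4 (-q) * theta4 q) UNIV"
    using has_sum_mult_UNIV[OF t3 t4] q by simp
  then have "((\<lambda>(m, n). e q n * (c m * e q m)) has_sum theta4 (-q) * theta4 q) UNIV"
    by (rule has_sum_reindex_bij_witness[where i = prod.swap and j = prod.swap, THEN iffD2, rotated -1])
       auto
  then have "((\<lambda>p. (case p of (m, n) \<Rightarrow> e q m * (c n * e q n)) + (case p of (m, n) \<Rightarrow> e q n * (c m * e q m)))
      has_sum theta4 (-q) * theta4 q + theta4 (-q) * theta4 q) UNIV"
    by (rule has_sum_add[OF mixed])
  then have "((\<lambda>(m, n). (c m + c n) * (e q m * e q n)) has_sum 2 * (theta4 (-q) * theta4 q)) UNIV"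
    by (simp add: case_prod_unfold algebra_simps)
  then have "((\<lambda>(a, b). (c (a + b) + c (a - b)) * (e (q\<^sup>2) a * e (q\<^sup>2) b)) has_sum 2 * (theta4 (-q) * theta4 q)) UNIV"
    by (drule_tac has_sum_even_lattice) (auto simp: e_lat c_def power_int_minus_left)
  moreover have "c (a - b) = c (a + b)" for a b
    by (simp add: c_def power_int_minus_left)
  ultimately have "((\<lambda>(a, b). 2 * ((c a * e (q\<^sup>2) a) * (c b * e (q\<^sup>2) b))) has_sum 2 * (theta4 (-q) * theta4 q)) UNIV"
    by (simp add: c_add algebra_simps)
  moreover have "((\<lambda>(a, b). 2 * ((c a * e (q\<^sup>2) a) * (c b * e (q\<^sup>2) b))) has_sum 2 * theta4 (q\<^sup>2) ^ 2) UNIV"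
    using has_sum_cmult_right[OF has_sum_mult_UNIV[OF t4 t4], OF q2 q2 q2 q2, of 2]
    by (simp add: power2_eq_square case_prod_unfold)
  ultimately have "2 * (theta4 (-q) * theta4 q) = 2 * theta4 (q\<^sup>2) ^ 2"
    by (rule has_sum_unique)
  then show "theta4 (-q) * theta4 q = theta4 (q\<^sup>2) ^ 2" by simp
qed

section \<open>Gauss's integrals and Landen's substitution\<close>

definition gauss_int :: "real \<Rightarrow> real \<Rightarrow> real" where
  "gauss_int a b = integral {0..pi/2} (\<lambda>x. 1 / sqrt (a\<^sup>2 * (cos x)\<^sup>2 + b\<^sup>2 * (sin x)\<^sup>2))"

definition gauss_sin_int :: "real \<Rightarrow> real \<Rightarrow> real" where
  "gauss_sin_int a b =
     integral {0..pi/2} (\<lambda>x. (sin x)\<^sup>2 / sqrt (a\<^sup>2 * (cos x)\<^sup>2 + b\<^sup>2 * (sin x)\<^sup>2))"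

lemma weighted_cos_sin_pos:
  fixes a b x :: real
  assumes "a > 0" "b > 0"
  shows "a * (cos x)\<^sup>2 + b * (sin x)\<^sup>2 > 0"
proof -
  have "a * (cos x)\<^sup>2 + b * (sin x)\<^sup>2 \<ge> min a b * (cos x)\<^sup>2 + min a b * (sin x)\<^sup>2"
    by (intro add_mono mult_right_mono) auto
  also have "min a b * (cos x)\<^sup>2 + min a b * (sin x)\<^sup>2 = min a b"
    by (simp flip: distrib_left)
  finally show ?thesis using assms by linarith
qed

lemma continuous_on_gauss_integrands:
  assumes "a > 0" "b > 0"
  shows "continuous_on A (\<lambda>x. 1 / sqrt (a\<^sup>2 * (cos x)\<^sup>2 + b\<^sup>2 * (sin x)\<^sup>2))"
    and "continuous_on A (\<lambda>x. (sin x)\<^sup>2 / sqrt (a\<^sup>2 * (cos x)\<^sup>2 + b\<^sup>2 * (sin x)\<^sup>2))"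
  using weighted_cos_sin_pos[of "a\<^sup>2" "b\<^sup>2"] assms
  by (auto intro!: continuous_intros simp: less_imp_neq[symmetric])

lemma integral_symmetric_half:
  fixes f :: "real \<Rightarrow> real"
  assumes "continuous_on {0..pi} f" "\<And>x. f (pi - x) = f x"
  shows "integral {0..pi} f = 2 * integral {0..pi/2} f"
proof -
  have int: "f integrable_on {0..pi}" by (rule integrable_continuous_real) fact
  have "((\<lambda>x. f (pi - x)) has_integral integral {0..pi/2} f) {pi/2..pi}"
  proof -
    have "f integrable_on {0..pi/2}"
      by (rule integrable_subinterval_real[OF int]) auto
    then have "(f has_integral integral {0..pi/2} f) (cbox 0 (pi/2))"
      unfolding box_real by (rule integrable_integral)
    from has_integral_affinity[OF this, of "-1" pi] show ?thesis
      by (simp add: field_simps)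
  qed
  then have "integral {pi/2..pi} f = integral {0..pi/2} f"
    using assms(2) by (simp add: integral_unique)
  moreover have "integral {0..pi/2} f + integral {pi/2..pi} f = integral {0..pi} f"
    by (rule Henstock_Kurzweil_Integration.integral_combine) (use int in auto)
  ultimately show ?thesis by simp
qed

text \<open>In terms of \<open>tan\<close> this is Landen's substitution \<open>y = x + arctan ((b / a) tan x)\<close>, which
  maps \<open>[0, pi/2]\<close> to \<open>[0, pi]\<close>. Written as \<open>2 x\<close> minus a correction it has no singularity at
  \<open>pi/2\<close>.\<close>

definition landen_map :: "real \<Rightarrow> real \<Rightarrow> real \<Rightarrow> real" where
  "landen_map a b x =
     2 * x - arctan ((a - b) * sin x * cos x / (a * (cos x)\<^sup>2 + b * (sin x)\<^sup>2))"

lemma landen_map_identities: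
  fixes a b c s :: real
  assumes "c\<^sup>2 + s\<^sup>2 = 1"
  defines "d \<equiv> a\<^sup>2 * c\<^sup>2 + b\<^sup>2 * s\<^sup>2" and "n \<equiv> a * c\<^sup>2 + b * s\<^sup>2"
  shows "n\<^sup>2 + ((a - b) * s * c)\<^sup>2 = d"
    and "d + a * b = (a + b) * n"
    and "(a - b) * ((c\<^sup>2 - s\<^sup>2) * n + 2 * (a - b) * s\<^sup>2 * c\<^sup>2) = d - a * b"
    and "2 * n - (a - b) * (c\<^sup>2 - s\<^sup>2) = a + b"
proof -
  have s: "s\<^sup>2 = 1 - c\<^sup>2" using assms(1) by simp
  show "n\<^sup>2 + ((a - b) * s * c)\<^sup>2 = d" "d + a * b = (a + b) * n"
    "(a - b) * ((c\<^sup>2 - s\<^sup>2) * n + 2 * (a - b) * s\<^sup>2 * c\<^sup>2) = d - a * b"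
    "2 * n - (a - b) * (c\<^sup>2 - s\<^sup>2) = a + b"
    unfolding d_def n_def power_mult_distrib s by algebra+
qed

text \<open>These are the three ingredients of the change of variables: the Jacobian, and the values of
  the new numerator and denominator. They combine to
  \<open>dy / sqrt (a1\<^sup>2 cos\<^sup>2 y + b1\<^sup>2 sin\<^sup>2 y) = 2 dx / sqrt (a\<^sup>2 cos\<^sup>2 x + b\<^sup>2 sin\<^sup>2 x)\<close> for the means
  \<open>a1\<close> and \<open>b1\<close>.\<close>

lemma landen_map_deriv:
  fixes a b x :: real
  assumes "a > 0" "b > 0"
  defines "d \<equiv> a\<^sup>2 * (cos x)\<^sup>2 + b\<^sup>2 * (sin x)\<^sup>2" and "n \<equiv> a * (cos x)\<^sup>2 + b * (sin x)\<^sup>2"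
  shows "(landen_map a b has_real_derivative (a + b) * n / d) (at x)"
    and "(sin (landen_map a b x))\<^sup>2 = (a + b)\<^sup>2 * (sin x)\<^sup>2 * (cos x)\<^sup>2 / d"
    and "((a + b) / 2)\<^sup>2 * (cos (landen_map a b x))\<^sup>2 + a * b * (sin (landen_map a b x))\<^sup>2
         = ((a + b) / 2)\<^sup>2 * n\<^sup>2 / d"
proof -
  let ?c = "cos x" and ?s = "sin x"
  define u where "u = (a - b) * ?s * ?c / n"
  have d: "d > 0" and n: "n > 0"
    using weighted_cos_sin_pos[of "a\<^sup>2" "b\<^sup>2" x] weighted_cos_sin_pos[of a b x] assms by auto
  note id = landen_map_identities[of ?c ?s a b, OF sin_cos_squared_add2, folded d_def n_def]
  have u: "1 + u\<^sup>2 = d / n\<^sup>2"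
    using n id(1) by (simp add: u_def power_divide field_simps)
  have "((\<lambda>x. 2 * x - arctan ((a - b) * sin x * cos x / (a * (cos x)\<^sup>2 + b * (sin x)\<^sup>2)))
      has_real_derivative
      2 - (a - b) * ((?c\<^sup>2 - ?s\<^sup>2) * n + 2 * (a - b) * ?s\<^sup>2 * ?c\<^sup>2) / n\<^sup>2 / (1 + u\<^sup>2)) (at x)"
    using n unfolding u_def n_def
    by (auto intro!: derivative_eq_intros simp: power2_eq_square divide_simps)
       (auto simp: algebra_simps)
  moreover have "2 - (a - b) * ((?c\<^sup>2 - ?s\<^sup>2) * n + 2 * (a - b) * ?s\<^sup>2 * ?c\<^sup>2) / n\<^sup>2 / (1 + u\<^sup>2)
      = (a + b) * n / d"
  proof -
    have "2 - (d - a * b) / n\<^sup>2 / (d / n\<^sup>2) = (d + a * b) / d"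
      using n d by (simp add: field_simps)
    then show ?thesis unfolding u id(2,3) .
  qed
  ultimately show "(landen_map a b has_real_derivative (a + b) * n / d) (at x)"
    unfolding landen_map_def[abs_def] by simp
  have "sin (landen_map a b x) = (2 * ?s * ?c - u * (?c\<^sup>2 - ?s\<^sup>2)) / sqrt (1 + u\<^sup>2)"
    unfolding landen_map_def n_def[symmetric] u_def[symmetric] sin_diff sin_double cos_double
      cos_arctan sin_arctan
    by (simp add: diff_divide_distrib)
  also have "2 * ?s * ?c - u * (?c\<^sup>2 - ?s\<^sup>2) = ?s * ?c * (2 * n - (a - b) * (?c\<^sup>2 - ?s\<^sup>2)) / n"
    using n by (simp add: u_def field_simps)
  also have "\<dots> = ?s * ?c * (a + b) / n"
    unfolding id(4) ..
  finally have "(sin (landen_map a b x))\<^sup>2 = (?s * ?c * (a + b) / n)\<^sup>2 / (1 + u\<^sup>2)"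
    by (simp add: power_divide power_mult_distrib)
  also have "\<dots> = (a + b)\<^sup>2 * ?s\<^sup>2 * ?c\<^sup>2 / d"
    using n d unfolding u by (simp add: power_divide power_mult_distrib)
  finally show sin: "(sin (landen_map a b x))\<^sup>2 = (a + b)\<^sup>2 * ?s\<^sup>2 * ?c\<^sup>2 / d" .
  have "((a + b) / 2)\<^sup>2 * (cos (landen_map a b x))\<^sup>2 + a * b * (sin (landen_map a b x))\<^sup>2
      = ((a + b) / 2)\<^sup>2 - ((a - b) / 2)\<^sup>2 * (sin (landen_map a b x))\<^sup>2"
    unfolding cos_squared_eq by (simp add: power2_eq_square field_simps)
  also have "\<dots> = ((a + b) / 2)\<^sup>2 * (d - ((a - b) * ?s * ?c)\<^sup>2) / d"
    using d unfolding sin power_mult_distrib power_divide by (simp add: field_simps)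
  also have "d - ((a - b) * ?s * ?c)\<^sup>2 = n\<^sup>2"
    using id(1) by simp
  finally show "((a + b) / 2)\<^sup>2 * (cos (landen_map a b x))\<^sup>2 + a * b * (sin (landen_map a b x))\<^sup>2
         = ((a + b) / 2)\<^sup>2 * n\<^sup>2 / d" .
qed

text \<open>The weight \<open>w\<close> is kept general because the substitution is needed both for \<open>gauss_int\<close>
  (\<open>w = 1\<close>) and for \<open>gauss_sin_int\<close> (\<open>w\<close> the identity). The factor \<open>2\<close> from the differential is
  absorbed by folding \<open>[0, pi]\<close> onto \<open>[0, pi/2]\<close>.\<close>

lemma landen_substitution:
  fixes w :: "real \<Rightarrow> real"
  assumes ab: "a > 0" "b > 0" and w: "continuous_on UNIV w"
  defines "a1 \<equiv> (a + b) / 2" and "b1 \<equiv> sqrt (a * b)"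
  shows "((\<lambda>x. w ((a + b)\<^sup>2 * (sin x)\<^sup>2 * (cos x)\<^sup>2 / (a\<^sup>2 * (cos x)\<^sup>2 + b\<^sup>2 * (sin x)\<^sup>2))
             / sqrt (a\<^sup>2 * (cos x)\<^sup>2 + b\<^sup>2 * (sin x)\<^sup>2)) has_integral
          integral {0..pi/2} (\<lambda>x. w ((sin x)\<^sup>2) / sqrt (a1\<^sup>2 * (cos x)\<^sup>2 + b1\<^sup>2 * (sin x)\<^sup>2))) {0..pi/2}"
proof -
  define f where "f = (\<lambda>x. w ((sin x)\<^sup>2) / sqrt (a1\<^sup>2 * (cos x)\<^sup>2 + b1\<^sup>2 * (sin x)\<^sup>2))"
  let ?g = "landen_map a b"
  let ?n = "\<lambda>x. a * (cos x)\<^sup>2 + b * (sin x)\<^sup>2" and ?d = "\<lambda>x. a\<^sup>2 * (cos x)\<^sup>2 + b\<^sup>2 * (sin x)\<^sup>2"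
  have d: "?d x > 0" and n: "?n x > 0" for x
    using weighted_cos_sin_pos[of "a\<^sup>2" "b\<^sup>2" x] weighted_cos_sin_pos[of a b x] assms by auto
  have a1: "a1 > 0" and b1: "b1 > 0" using ab by (auto simp: a1_def b1_def)
  have cont: "continuous_on A f" for A
    unfolding f_def using weighted_cos_sin_pos[of "a1\<^sup>2" "b1\<^sup>2"] a1 b1
    by (auto intro!: continuous_intros continuous_on_compose2[OF w] simp: less_imp_neq[symmetric])
  have deriv: "(?g has_real_derivative (a + b) * ?n x / ?d x) (at x)" for x
    by (rule landen_map_deriv(1)[OF ab])
  have g0: "?g 0 = 0" "?g (pi/2) = pi" by (simp_all add: landen_map_def)
  have mono: "?g x \<le> ?g y" if "x \<le> y" for x y
  proof (rule DERIV_nonneg_imp_nondecreasing[OF that])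
    fix z
    have "0 \<le> (a + b) * ?n z / ?d z"
      using ab n[of z] d[of z] by (intro divide_nonneg_pos mult_nonneg_nonneg) auto
    then show "\<exists>y. (?g has_real_derivative y) (at z) \<and> 0 \<le> y" using deriv by blast
  qed
  have "((\<lambda>x. ((a + b) * ?n x / ?d x) *\<^sub>R f (?g x)) has_integral integral {?g 0..?g (pi/2)} f) {0..pi/2}"
  proof (rule has_integral_substitution)
    show "?g ` {0..pi/2} \<subseteq> {0..pi}"
      using mono[of 0] mono[of _ "pi/2"] by (auto simp: g0)
    show "(?g has_real_derivative (a + b) * ?n x / ?d x) (at x within {0..pi/2})" for x
      using deriv by (rule DERIV_subset) auto
  qed (auto simp: g0 cont)
  also have "integral {?g 0..?g (pi/2)} f = 2 * integral {0..pi/2} f"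
    unfolding g0 by (rule integral_symmetric_half[OF cont]) (simp add: f_def)
  also have "(\<lambda>x. ((a + b) * ?n x / ?d x) *\<^sub>R f (?g x))
      = (\<lambda>x. 2 * (w ((a + b)\<^sup>2 * (sin x)\<^sup>2 * (cos x)\<^sup>2 / ?d x) / sqrt (?d x)))"
  proof
    fix x
    have "sqrt (a1\<^sup>2 * (cos (?g x))\<^sup>2 + b1\<^sup>2 * (sin (?g x))\<^sup>2) = a1 * ?n x / sqrt (?d x)"
    proof -
      have "a1\<^sup>2 * (cos (?g x))\<^sup>2 + b1\<^sup>2 * (sin (?g x))\<^sup>2 = (a1 * ?n x)\<^sup>2 / ?d x"
        using landen_map_deriv(3)[OF ab, of x] ab unfolding power_mult_distrib[of a1]
        by (simp add: a1_def b1_def)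
      moreover have "a1 * ?n x \<ge> 0" using a1 n[of x] by (intro mult_nonneg_nonneg) auto
      ultimately show ?thesis by (simp only: real_sqrt_divide real_sqrt_abs abs_of_nonneg)
    qed
    then have "f (?g x) = w ((a + b)\<^sup>2 * (sin x)\<^sup>2 * (cos x)\<^sup>2 / ?d x) * sqrt (?d x) / (a1 * ?n x)"
      unfolding f_def landen_map_deriv(2)[OF ab] by simp
    moreover have "(a + b) * N / D * (W * r / (a1 * N)) = 2 * (W / r)" if "r * r = D" "N > 0" "r > 0" for N D W r
    proof -
      have "a + b = 2 * a1" by (simp add: a1_def)
      then show ?thesis using that(2,3) a1 unfolding that(1)[symmetric] by simp
    qed
    note this[of "sqrt (?d x)" "?d x" "?n x"]
    ultimately show "((a + b) * ?n x / ?d x) *\<^sub>R f (?g x)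
        = 2 * (w ((a + b)\<^sup>2 * (sin x)\<^sup>2 * (cos x)\<^sup>2 / ?d x) / sqrt (?d x))"
      using d[of x] n[of x] by simp
  qed
  finally have "((\<lambda>x. 1 / 2 * (2 * (w ((a + b)\<^sup>2 * (sin x)\<^sup>2 * (cos x)\<^sup>2 / ?d x) / sqrt (?d x))))
      has_integral 1 / 2 * (2 * integral {0..pi/2} f)) {0..pi/2}"
    by (rule has_integral_mult_right)
  then show ?thesis by (simp add: f_def)
qed

lemma gauss_int_agm:
  assumes "a > 0" "b > 0"
  shows "gauss_int ((a + b) / 2) (sqrt (a * b)) = gauss_int a b"
  using integral_unique[OF landen_substitution[OF assms, of "\<lambda>_. 1"]]
  by (simp add: gauss_int_def)

lemma gauss_int_has_integral:
  assumes "a > 0" "b > 0"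
  shows "((\<lambda>x. 1 / sqrt (a\<^sup>2 * (cos x)\<^sup>2 + b\<^sup>2 * (sin x)\<^sup>2)) has_integral gauss_int a b) {0..pi/2}"
    and "((\<lambda>x. (sin x)\<^sup>2 / sqrt (a\<^sup>2 * (cos x)\<^sup>2 + b\<^sup>2 * (sin x)\<^sup>2)) has_integral gauss_sin_int a b) {0..pi/2}"
  unfolding gauss_int_def gauss_sin_int_def
  by (intro integrable_integral integrable_continuous_real continuous_on_gauss_integrands assms)+

text \<open>The difference of both integrands is the derivative of \<open>sin x cos x / sqrt (d x)\<close>, which
  vanishes at both ends. The left-hand side arises in two places: from Landen's substitution in
  \<open>gauss_sin_int\<close>, and from differentiating \<open>gauss_sin_int\<close> with respect to a parameter.\<close>

lemma gauss_int_by_parts: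
  fixes a b :: real
  assumes ab: "a > 0" "b > 0"
  defines "d \<equiv> \<lambda>x. a\<^sup>2 * (cos x)\<^sup>2 + b\<^sup>2 * (sin x)\<^sup>2"
  shows "((\<lambda>x. (a\<^sup>2 - b\<^sup>2) * ((sin x)\<^sup>2 * (cos x)\<^sup>2 / (d x * sqrt (d x))))
      has_integral 2 * gauss_sin_int a b - gauss_int a b) {0..pi/2}"
proof -
  have d: "d x > 0" for x
    using weighted_cos_sin_pos[of "a\<^sup>2" "b\<^sup>2" x] assms by auto
  have A: "((\<lambda>x. 2 * ((sin x)\<^sup>2 / sqrt (d x)) - 1 / sqrt (d x)) has_integral
      2 * gauss_sin_int a b - gauss_int a b) {0..pi/2}"
    unfolding d_def by (intro has_integral_mult_right has_integral_diff gauss_int_has_integral ab)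
  have "((\<lambda>x. (a\<^sup>2 - b\<^sup>2) * ((sin x)\<^sup>2 * (cos x)\<^sup>2 / (d x * sqrt (d x)))
        - (2 * ((sin x)\<^sup>2 / sqrt (d x)) - 1 / sqrt (d x))) has_integral
      sin (pi/2) * cos (pi/2) / sqrt (d (pi/2)) - sin 0 * cos 0 / sqrt (d 0)) {0..pi/2}"
  proof (rule fundamental_theorem_of_calculus)
    fix x :: real
    define r where "r = sqrt (d x)"
    have r: "r > 0" "r\<^sup>2 = d x" using d[of x] by (auto simp: r_def)
    have sq: "(sin x)\<^sup>2 = 1 - (cos x)\<^sup>2" by (simp add: sin_squared_eq)
    have "((\<lambda>x. sin x * cos x / sqrt (d x)) has_real_derivative
        ((cos x)\<^sup>2 - (sin x)\<^sup>2) / r + (a\<^sup>2 - b\<^sup>2) * (sin x)\<^sup>2 * (cos x)\<^sup>2 / r ^ 3) (at x)"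
      using d[of x] r unfolding r_def d_def
      by (auto intro!: derivative_eq_intros simp: power2_eq_square power3_eq_cube divide_simps)
         (auto simp: algebra_simps)
    moreover have "((cos x)\<^sup>2 - (sin x)\<^sup>2) / r + (a\<^sup>2 - b\<^sup>2) * (sin x)\<^sup>2 * (cos x)\<^sup>2 / r ^ 3
        = (a\<^sup>2 - b\<^sup>2) * ((sin x)\<^sup>2 * (cos x)\<^sup>2 / (r\<^sup>2 * r)) - (2 * ((sin x)\<^sup>2 / r) - 1 / r)"
      unfolding sq using r(1) by (simp add: field_simps power2_eq_square power3_eq_cube)
    ultimately have "((\<lambda>x. sin x * cos x / sqrt (d x)) has_real_derivative
        (a\<^sup>2 - b\<^sup>2) * ((sin x)\<^sup>2 * (cos x)\<^sup>2 / (d x * sqrt (d x)))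
        - (2 * ((sin x)\<^sup>2 / sqrt (d x)) - 1 / sqrt (d x))) (at x)"
      unfolding r_def[symmetric] unfolding r(2)[symmetric] by simp
    then show "((\<lambda>x. sin x * cos x / sqrt (d x)) has_vector_derivative
        (a\<^sup>2 - b\<^sup>2) * ((sin x)\<^sup>2 * (cos x)\<^sup>2 / (d x * sqrt (d x)))
        - (2 * ((sin x)\<^sup>2 / sqrt (d x)) - 1 / sqrt (d x))) (at x within {0..pi/2})"
      by (rule has_vector_derivative_at_within[OF has_real_derivative_iff_has_vector_derivative[THEN iffD1]])
  qed auto
  from has_integral_add[OF this A] show ?thesis by simp
qed

lemma gauss_sin_int_agm:
  assumes ab: "a > 0" "b > 0"
  shows "(a - b)\<^sup>2 * gauss_sin_int ((a + b) / 2) (sqrt (a * b))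
       = (a\<^sup>2 - b\<^sup>2) * (2 * gauss_sin_int a b - gauss_int a b)"
proof -
  let ?d = "\<lambda>x. a\<^sup>2 * (cos x)\<^sup>2 + b\<^sup>2 * (sin x)\<^sup>2"
  have "((\<lambda>x. (a - b)\<^sup>2 * ((a + b)\<^sup>2 * (sin x)\<^sup>2 * (cos x)\<^sup>2 / ?d x / sqrt (?d x)))
      has_integral (a - b)\<^sup>2 * gauss_sin_int ((a + b) / 2) (sqrt (a * b))) {0..pi/2}"
    unfolding gauss_sin_int_def
    by (rule has_integral_mult_right[OF landen_substitution[OF ab, of "\<lambda>x. x"]]) (rule continuous_on_id)
  moreover have "(a - b)\<^sup>2 * ((a + b)\<^sup>2 * s * c / d / r) = (a\<^sup>2 - b\<^sup>2) * ((a\<^sup>2 - b\<^sup>2) * (s * c / (d * r)))"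
    for s c d r :: real
    by (simp add: square_diff_square_factored power2_eq_square)
  ultimately have "((\<lambda>x. (a\<^sup>2 - b\<^sup>2) * ((a\<^sup>2 - b\<^sup>2) * ((sin x)\<^sup>2 * (cos x)\<^sup>2 / (?d x * sqrt (?d x)))))
      has_integral (a - b)\<^sup>2 * gauss_sin_int ((a + b) / 2) (sqrt (a * b))) {0..pi/2}"
    by (simp only:)
  then show ?thesis
    by (rule has_integral_unique[OF _ has_integral_mult_right[OF gauss_int_by_parts[OF ab]]])
qed

lemma gauss_int_bounds:
  assumes "0 < b" "b \<le> a"
  shows "pi / (2 * a) \<le> gauss_int a b" "gauss_int a b \<le> pi / (2 * b)"
    and "0 \<le> gauss_sin_int a b" "gauss_sin_int a b \<le> pi / (2 * b)"
proof -
  let ?d = "\<lambda>x. a\<^sup>2 * (cos x)\<^sup>2 + b\<^sup>2 * (sin x)\<^sup>2"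
  have ab: "a > 0" "b > 0" using assms by auto
  have d: "?d x > 0" for x
    using weighted_cos_sin_pos[of "a\<^sup>2" "b\<^sup>2" x] ab by auto
  have "b\<^sup>2 \<le> a\<^sup>2" using assms by (intro power_mono) auto
  then have "0 \<le> (a\<^sup>2 - b\<^sup>2) * (cos x)\<^sup>2" "0 \<le> (a\<^sup>2 - b\<^sup>2) * (sin x)\<^sup>2" for x by simp_all
  moreover have "?d x = b\<^sup>2 + (a\<^sup>2 - b\<^sup>2) * (cos x)\<^sup>2" "?d x = a\<^sup>2 - (a\<^sup>2 - b\<^sup>2) * (sin x)\<^sup>2" for x
    by (simp_all add: sin_squared_eq algebra_simps)
  ultimately have lo: "b\<^sup>2 \<le> ?d x" and hi: "?d x \<le> a\<^sup>2" for x
    by (smt (verit))+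
  have lo': "b \<le> sqrt (?d x)" and hi': "sqrt (?d x) \<le> a" for x
    using ab lo[of x] hi[of x] by (auto intro: real_le_rsqrt real_le_lsqrt)
  have const: "((\<lambda>x. c) has_integral pi / 2 * c) {0..pi/2}" for c :: real
    using has_integral_const_real[of c 0 "pi/2"] by simp
  have 1: "1 / a \<le> 1 / sqrt (?d x)" "1 / sqrt (?d x) \<le> 1 / b" for x
    using ab lo'[of x] hi'[of x] d[of x] by (auto intro!: divide_left_mono mult_pos_pos)
  have 2: "0 \<le> (sin x)\<^sup>2 / sqrt (?d x)" "(sin x)\<^sup>2 / sqrt (?d x) \<le> 1 / b" for x
  proof -
    show "0 \<le> (sin x)\<^sup>2 / sqrt (?d x)"
      using less_imp_le[OF d[of x]] by (intro divide_nonneg_nonneg real_sqrt_ge_zero) auto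
    have "(sin x)\<^sup>2 \<le> 1"
      using sin_cos_squared_add[of x] zero_le_power2[of "cos x"] by linarith
    then show "(sin x)\<^sup>2 / sqrt (?d x) \<le> 1 / b"
      using ab lo'[of x] by (intro frac_le) auto
  qed
  show "pi / (2 * a) \<le> gauss_int a b"
    using has_integral_le[OF const gauss_int_has_integral(1)[OF ab] 1(1)] by simp
  show "gauss_int a b \<le> pi / (2 * b)"
    using has_integral_le[OF gauss_int_has_integral(1)[OF ab] const 1(2)] by simp
  show "0 \<le> gauss_sin_int a b"
    by (rule has_integral_nonneg[OF gauss_int_has_integral(2)[OF ab] 2(1)])
  show "gauss_sin_int a b \<le> pi / (2 * b)"
    using has_integral_le[OF gauss_int_has_integral(2)[OF ab] const 2(2)] by simp
qed

lemma gauss_int_scale: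
  assumes "l > 0"
  shows "gauss_int (l * a) (l * b) = gauss_int a b / l"
    and "gauss_sin_int (l * a) (l * b) = gauss_sin_int a b / l"
proof -
  have "sqrt ((l * a)\<^sup>2 * (cos x)\<^sup>2 + (l * b)\<^sup>2 * (sin x)\<^sup>2)
      = l * sqrt (a\<^sup>2 * (cos x)\<^sup>2 + b\<^sup>2 * (sin x)\<^sup>2)" for x
  proof -
    have "(l * a)\<^sup>2 * (cos x)\<^sup>2 + (l * b)\<^sup>2 * (sin x)\<^sup>2 = l\<^sup>2 * (a\<^sup>2 * (cos x)\<^sup>2 + b\<^sup>2 * (sin x)\<^sup>2)"
      by (simp add: power_mult_distrib distrib_left mult.assoc)
    then show ?thesis using assms by (simp only: real_sqrt_mult real_sqrt_abs abs_of_pos)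
  qed
  then have "1 / sqrt ((l * a)\<^sup>2 * (cos x)\<^sup>2 + (l * b)\<^sup>2 * (sin x)\<^sup>2)
      = 1 / sqrt (a\<^sup>2 * (cos x)\<^sup>2 + b\<^sup>2 * (sin x)\<^sup>2) / l"
    "(sin x)\<^sup>2 / sqrt ((l * a)\<^sup>2 * (cos x)\<^sup>2 + (l * b)\<^sup>2 * (sin x)\<^sup>2)
      = (sin x)\<^sup>2 / sqrt (a\<^sup>2 * (cos x)\<^sup>2 + b\<^sup>2 * (sin x)\<^sup>2) / l" for x
    by (simp_all add: mult.commute)
  then show "gauss_int (l * a) (l * b) = gauss_int a b / l"
    and "gauss_sin_int (l * a) (l * b) = gauss_sin_int a b / l"
    by (simp_all only: gauss_int_def gauss_sin_int_def integral_divide)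
qed

text \<open>For \<open>a\<^sup>2 = b\<^sup>2 + c\<^sup>2\<close> the radicand is \<open>c\<^sup>2 + b\<^sup>2 cos\<^sup>2 x\<close>. With numerator \<open>sin x\<close> instead of
  \<open>1\<close> the integral is elementary and equals \<open>arsinh (b / c) / b\<close>, while the remainder with
  numerator \<open>1 - sin x \<le> cos x\<close> stays bounded as \<open>c\<close> tends to \<open>0\<close>. This captures the
  logarithmic singularity of the complete integral of the first kind.\<close>

lemma gauss_int_log_bounds:
  assumes bc: "b > 0" "c > 0" and a: "a = sqrt (b\<^sup>2 + c\<^sup>2)"
  shows "arsinh (b / c) / b \<le> gauss_int a c"
    and "gauss_int a c \<le> arsinh (b / c) / b + pi / (2 * b)"
proof -
  have a_pos: "a > 0" unfolding a by (intro real_sqrt_gt_zero add_pos_pos) (use bc in auto)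
  let ?d = "\<lambda>x. c\<^sup>2 + b\<^sup>2 * (cos x)\<^sup>2"
  have d: "?d x > 0" for x using bc by (intro add_pos_nonneg) auto
  have "a\<^sup>2 * (cos x)\<^sup>2 + c\<^sup>2 * (sin x)\<^sup>2 = ?d x" for x
    unfolding a by (simp add: sin_squared_eq algebra_simps)
  then have G: "((\<lambda>x. 1 / sqrt (?d x)) has_integral gauss_int a c) {0..pi/2}"
    using gauss_int_has_integral(1)[OF a_pos bc(2)] by simp
  have "((\<lambda>x. sin x / sqrt (?d x)) has_integral
      - (arsinh (b / c * cos (pi/2)) / b) - - (arsinh (b / c * cos 0) / b)) {0..pi/2}"
  proof (rule fundamental_theorem_of_calculus)
    fix x :: real
    have "sqrt ((b / c * cos x)\<^sup>2 + 1) = sqrt (?d x / c\<^sup>2)"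
      using bc by (simp add: power_mult_distrib power_divide field_simps)
    also have "\<dots> = sqrt (?d x) / c" using bc by (simp add: real_sqrt_divide)
    finally have s: "sqrt ((b / c * cos x)\<^sup>2 + 1) = sqrt (?d x) / c" .
    have "((\<lambda>x. - (arsinh (b / c * cos x) / b)) has_real_derivative
        - (1 / sqrt ((b / c * cos x)\<^sup>2 + 1) * (b / c * - sin x) / b)) (at x)"
      by (intro DERIV_minus DERIV_cdivide DERIV_chain2[OF arsinh_real_has_field_derivative]
          DERIV_cmult DERIV_cos)
    also have "- (1 / sqrt ((b / c * cos x)\<^sup>2 + 1) * (b / c * - sin x) / b) = sin x / sqrt (?d x)"
      unfolding s using bc d[of x] by (simp add: field_simps)
    finally show "((\<lambda>x. - (arsinh (b / c * cos x) / b)) has_vector_derivative sin x / sqrt (?d x))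
        (at x within {0..pi/2})"
      by (rule has_vector_derivative_at_within[OF has_real_derivative_iff_has_vector_derivative[THEN iffD1]])
  qed auto
  then have S: "((\<lambda>x. sin x / sqrt (?d x)) has_integral arsinh (b / c) / b) {0..pi/2}"
    by simp
  show "arsinh (b / c) / b \<le> gauss_int a c"
    by (rule has_integral_le[OF S G]) (use d in \<open>auto intro!: divide_right_mono simp: less_imp_le\<close>)
  have U: "((\<lambda>x. sin x / sqrt (?d x) + 1 / b) has_integral arsinh (b / c) / b + pi / 2 * (1 / b)) {0..pi/2}"
    using has_integral_add[OF S has_integral_const_real[of "1 / b" 0 "pi/2"]] by simp
  have "gauss_int a c \<le> arsinh (b / c) / b + pi / 2 * (1 / b)"
  proof (rule has_integral_le[OF G U])
    fix x :: real assume "x \<in> {0..pi/2}"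
    then have sc: "0 \<le> sin x" "0 \<le> cos x"
      by (auto intro: sin_ge_zero cos_ge_zero)
    have "1 \<le> sin x + cos x"
    proof (rule power2_le_imp_le)
      show "1\<^sup>2 \<le> (sin x + cos x)\<^sup>2"
        using sc by (simp add: power2_sum)
    qed (use sc in auto)
    moreover have "b * cos x \<le> sqrt (?d x)"
      by (rule real_le_rsqrt) (simp add: power_mult_distrib)
    then have "cos x \<le> sqrt (?d x) / b" using bc by (simp add: field_simps)
    ultimately have "1 \<le> sin x + sqrt (?d x) / b" by linarith
    then have "1 / sqrt (?d x) \<le> (sin x + sqrt (?d x) / b) / sqrt (?d x)"
      using d[of x] by (intro divide_right_mono) auto
    also have "\<dots> = sin x / sqrt (?d x) + 1 / b"
      using d[of x] by (simp add: add_divide_distrib)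
    finally show "1 / sqrt (?d x) \<le> sin x / sqrt (?d x) + 1 / b" .
  qed
  then show "gauss_int a c \<le> arsinh (b / c) / b + pi / (2 * b)" by simp
qed

section \<open>The actions of the pendulum as Gauss integrals\<close>

lemma pend_modulus_inverse:
  assumes "h > 0"
  shows "1 / pend_modulus h = sqrt (1 + h / 2)" "(pend_modulus h)\<^sup>2 = 1 / (1 + h / 2)"
    "(pend_comodulus h)\<^sup>2 = (h / 2) / (1 + h / 2)"
proof -
  have e: "2 / (2 + h) = 1 / (1 + h / 2)" using assms by (simp add: field_simps)
  show "1 / pend_modulus h = sqrt (1 + h / 2)"
    unfolding pend_modulus_def e by (simp add: real_sqrt_divide)
  show *: "(pend_modulus h)\<^sup>2 = 1 / (1 + h / 2)"
    unfolding pend_modulus_def e using assms by simp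
  show "(pend_comodulus h)\<^sup>2 = (h / 2) / (1 + h / 2)"
    unfolding pend_comodulus_def * using assms by (simp add: field_simps)
qed

lemma pend_I_eq:
  assumes "h > 0"
  shows "pend_I h = 4 / pi * integral {0..pi/2} (\<lambda>x. sqrt ((1 + h / 2) * (cos x)\<^sup>2 + h / 2 * (sin x)\<^sup>2))"
proof -
  define e where "e = 1 + h / 2"
  have e: "e > 0" using assms by (simp add: e_def)
  have "sqrt e * sqrt (1 - 1 / e * (sin x)\<^sup>2) = sqrt (e * (cos x)\<^sup>2 + h / 2 * (sin x)\<^sup>2)" for x
  proof -
    have "e * (1 - 1 / e * (sin x)\<^sup>2) = e * (cos x)\<^sup>2 + h / 2 * (sin x)\<^sup>2"
      using e unfolding cos_squared_eq by (simp add: e_def field_simps)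
    then show ?thesis by (metis real_sqrt_mult)
  qed
  then have "sqrt e * ellipticE (pend_modulus h)
      = integral {0..pi/2} (\<lambda>x. sqrt (e * (cos x)\<^sup>2 + h / 2 * (sin x)\<^sup>2))"
    unfolding ellipticE_def pend_modulus_inverse(2)[OF assms] e_def[symmetric]
    by (simp flip: integral_mult_right)
  moreover have "pend_I h = 4 / pi * (1 / pend_modulus h * ellipticE (pend_modulus h))"
    by (simp add: pend_I_def)
  ultimately show ?thesis
    unfolding e_def pend_modulus_inverse(1)[OF assms] by simp
qed

lemma pend_J_eq:
  assumes "h > 0"
  shows "pend_J h = 4 * h / pi * gauss_sin_int (sqrt (1 + h / 2)) 1"
proof -
  define e where "e = 1 + h / 2"
  have e: "e > 0" using assms by (simp add: e_def)
  let ?d = "\<lambda>x. e * (cos x)\<^sup>2 + (sin x)\<^sup>2"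
  have d: "?d x > 0" for x
    using weighted_cos_sin_pos[of e 1 x] e by simp
  have x: "1 - (h / 2) / e * (sin x)\<^sup>2 = ?d x / e" for x
    using e unfolding cos_squared_eq by (simp add: e_def field_simps)
  have c: "continuous_on {0..pi/2} (\<lambda>x. 1 / sqrt (?d x / e))" "continuous_on {0..pi/2} (\<lambda>x. sqrt (?d x / e))"
    using d e by (auto intro!: continuous_intros simp: less_imp_neq[symmetric])
  have "ellipticK (pend_comodulus h) - ellipticE (pend_comodulus h)
      = integral {0..pi/2} (\<lambda>x. 1 / sqrt (?d x / e) - sqrt (?d x / e))"
    unfolding ellipticK_def ellipticE_def pend_modulus_inverse(3)[OF assms] e_def[symmetric] x
    by (intro integral_diff[symmetric] integrable_continuous_real c)
  also have "(\<lambda>x. 1 / sqrt (?d x / e) - sqrt (?d x / e)) = (\<lambda>x. h / 2 / sqrt e * ((sin x)\<^sup>2 / sqrt (?d x)))"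
  proof
    fix x
    have "1 / sqrt (?d x / e) - sqrt (?d x / e) = (1 - sqrt (?d x / e) * sqrt (?d x / e)) / sqrt (?d x / e)"
      using d[of x] e by (simp add: field_simps)
    also have "sqrt (?d x / e) * sqrt (?d x / e) = ?d x / e"
      using d[of x] e by simp
    also have "1 - ?d x / e = (h / 2) / e * (sin x)\<^sup>2" using x[of x] by simp
    also have "h / 2 / e * (sin x)\<^sup>2 / sqrt (?d x / e) = h / 2 / sqrt e * ((sin x)\<^sup>2 / sqrt (?d x))"
    proof -
      have "e = sqrt e * sqrt e" using e by simp
      moreover have "h / 2 / (t * t) * s / (r / t) = h / 2 / t * (s / r)" for s r t :: real by simp
      ultimately have "h / 2 / e * s / (r / sqrt e) = h / 2 / sqrt e * (s / r)" for s r
        by metis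
      then show ?thesis by (simp add: real_sqrt_divide)
    qed
    finally show "1 / sqrt (?d x / e) - sqrt (?d x / e) = h / 2 / sqrt e * ((sin x)\<^sup>2 / sqrt (?d x))" .
  qed
  also have "integral {0..pi/2} \<dots> = h / 2 / sqrt e * gauss_sin_int (sqrt e) 1"
    using e by (simp only: integral_mult_right) (simp add: gauss_sin_int_def)
  finally show ?thesis
    using e unfolding pend_J_def e_def[symmetric]
      divide_divide_eq_left[symmetric, of 8 pi] divide_inverse[of "8/pi"] inverse_eq_divide
      pend_modulus_inverse(1)[OF assms]
    by (simp add: field_simps)
qed

lemma pend_I_deriv:
  assumes h: "h > 0"
  shows "(pend_I has_real_derivative 1 / pi * gauss_int (sqrt (1 + h / 2)) (sqrt (h / 2))) (at h)"
proof -
  let ?d = "\<lambda>h x. (1 + h / 2) * (cos x)\<^sup>2 + h / 2 * (sin x)\<^sup>2"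
  have d: "?d y x > 0" if "y > 0" for y x :: real
    using weighted_cos_sin_pos[of "1 + y / 2" "y / 2" x] that by simp
  have "((\<lambda>y. integral (cbox 0 (pi/2)) (\<lambda>x. sqrt (?d y x))) has_field_derivative
      integral (cbox 0 (pi/2)) (\<lambda>x. 1 / (4 * sqrt (?d h x)))) (at h within {0<..})"
  proof (rule leibniz_rule_field_derivative)
    fix y x :: real assume "y \<in> {0<..}"
    then have y: "y > 0" by simp
    have "((\<lambda>y. sqrt (?d y x)) has_real_derivative
        (inverse (sqrt (?d y x)) / 2) * (1 / 2 * (cos x)\<^sup>2 + 1 / 2 * (sin x)\<^sup>2)) (at y within {0<..})"
      using d[OF y, of x] by (auto intro!: derivative_eq_intros)
    moreover have "1 / 2 * (cos x)\<^sup>2 + 1 / 2 * (sin x)\<^sup>2 = 1 / 2"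
      using sin_cos_squared_add[of x] by linarith
    ultimately show "((\<lambda>y. sqrt (?d y x)) has_real_derivative 1 / (4 * sqrt (?d y x))) (at y within {0<..})"
      by (simp add: field_simps)
  next
    fix y :: real assume "y \<in> {0<..}"
    show "(\<lambda>x. sqrt (?d y x)) integrable_on cbox 0 (pi/2)"
      by (intro integrable_continuous continuous_intros)
  next
    show "continuous_on ({0<..} \<times> cbox 0 (pi/2)) (\<lambda>(y, x). 1 / (4 * sqrt (?d y x)))"
      using d by (auto intro!: continuous_intros simp: case_prod_unfold less_imp_neq[symmetric])
  qed (use h in auto)
  then have "((\<lambda>y. 4 / pi * integral {0..pi/2} (\<lambda>x. sqrt (?d y x))) has_field_derivative
      4 / pi * integral {0..pi/2} (\<lambda>x. 1 / (4 * sqrt (?d h x)))) (at h)"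
    using h by (intro DERIV_cmult) (simp add: at_within_open[of h "{0<..}"])
  moreover have "4 / pi * integral {0..pi/2} (\<lambda>x. 1 / (4 * sqrt (?d h x)))
      = 1 / pi * gauss_int (sqrt (1 + h / 2)) (sqrt (h / 2))"
  proof -
    have "(\<lambda>x. 1 / (4 * sqrt (?d h x))) = (\<lambda>x. 1 / 4 * (1 / sqrt (?d h x)))" by simp
    then show ?thesis using h by (simp only: integral_mult_right) (simp add: gauss_int_def)
  qed
  ultimately have "((\<lambda>y. 4 / pi * integral {0..pi/2} (\<lambda>x. sqrt (?d y x))) has_field_derivative
      1 / pi * gauss_int (sqrt (1 + h / 2)) (sqrt (h / 2))) (at h)" by simp
  then show ?thesis
    by (rule has_field_derivative_transform_within_open[where S = "{0<..}"])
       (use h in \<open>auto simp: pend_I_eq\<close>)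
qed

text \<open>Differentiation under the integral sign does not give the integrand of \<open>gauss_int\<close>
  pointwise; the two differ by an exact derivative, which is removed by
  \<open>gauss_int_by_parts\<close>.\<close>

lemma pend_J_deriv:
  assumes h: "h > 0"
  shows "(pend_J has_real_derivative 2 / pi * gauss_int (sqrt (1 + h / 2)) 1) (at h)"
proof -
  let ?d = "\<lambda>h x. (1 + h / 2) * (cos x)\<^sup>2 + (sin x)\<^sup>2"
  have d: "?d y x > 0" if "y > 0" for y x :: real
    using weighted_cos_sin_pos[of "1 + y / 2" 1 x] that by simp
  define D where "D = (\<lambda>y x. (sin x)\<^sup>2 / sqrt (?d y x)
      - y / 4 * ((sin x)\<^sup>2 * (cos x)\<^sup>2 / (?d y x * sqrt (?d y x))))"
  have "((\<lambda>y. integral (cbox 0 (pi/2)) (\<lambda>x. y * ((sin x)\<^sup>2 / sqrt (?d y x)))) has_field_derivative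
      integral (cbox 0 (pi/2)) (D h)) (at h within {0<..})"
  proof (rule leibniz_rule_field_derivative)
    fix y x :: real assume "y \<in> {0<..}"
    then have y: "y > 0" by simp
    define r where "r = sqrt (?d y x)"
    have r: "r > 0" "r * r = ?d y x" using d[OF y, of x] by (simp_all add: r_def)
    have "((\<lambda>y. sqrt (?d y x)) has_real_derivative (cos x)\<^sup>2 / (4 * r)) (at y within {0<..})"
      using d[OF y, of x] unfolding r_def by (auto intro!: derivative_eq_intros simp: field_simps)
    from DERIV_mult[OF DERIV_ident DERIV_divide[OF DERIV_const[of "(sin x)\<^sup>2"] this]]
    have "((\<lambda>y. y * ((sin x)\<^sup>2 / sqrt (?d y x))) has_real_derivative
        1 * ((sin x)\<^sup>2 / r) + (0 * r - (sin x)\<^sup>2 * ((cos x)\<^sup>2 / (4 * r))) / (r * r) * y) (at y within {0<..})"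
      unfolding r_def[symmetric] using r(1) by (simp add: r_def)
    moreover have "1 * ((sin x)\<^sup>2 / r) + (0 * r - (sin x)\<^sup>2 * ((cos x)\<^sup>2 / (4 * r))) / (r * r) * y = D y x"
      unfolding D_def r_def[symmetric] unfolding r(2)[symmetric] using r(1) by (simp add: field_simps)
    ultimately show "((\<lambda>y. y * ((sin x)\<^sup>2 / sqrt (?d y x))) has_real_derivative D y x) (at y within {0<..})"
      by simp
  next
    fix y :: real assume "y \<in> {0<..}"
    then show "(\<lambda>x. y * ((sin x)\<^sup>2 / sqrt (?d y x))) integrable_on cbox 0 (pi/2)"
      using d[of y] by (intro integrable_continuous continuous_intros) (auto simp: less_imp_neq[symmetric])
  next
    show "continuous_on ({0<..} \<times> cbox 0 (pi/2)) (\<lambda>(y, x). D y x)"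
      using d unfolding D_def by (auto intro!: continuous_intros simp: case_prod_unfold less_imp_neq[symmetric])
  qed (use h in auto)
  moreover have "(D h has_integral 1 / 2 * gauss_int (sqrt (1 + h / 2)) 1) {0..pi/2}"
  proof -
    have e: "sqrt (1 + h / 2) > 0" using h by simp
    have "((\<lambda>x. (sin x)\<^sup>2 / sqrt (?d h x) - 1 / 2 * (h / 2 * ((sin x)\<^sup>2 * (cos x)\<^sup>2 / (?d h x * sqrt (?d h x)))))
        has_integral gauss_sin_int (sqrt (1 + h / 2)) 1 -
          1 / 2 * (2 * gauss_sin_int (sqrt (1 + h / 2)) 1 - gauss_int (sqrt (1 + h / 2)) 1)) {0..pi/2}"
      using has_integral_diff[OF gauss_int_has_integral(2)[OF e zero_less_one]
          has_integral_mult_right[OF gauss_int_by_parts[OF e zero_less_one], of "1/2"]] h by simp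
    moreover have "s - 1 / 2 * (2 * s - g) = 1 / 2 * g" for s g :: real
      by (simp add: field_simps)
    ultimately show ?thesis by (simp only: D_def[abs_def]) simp
  qed
  ultimately have "((\<lambda>y. 4 / pi * integral {0..pi/2} (\<lambda>x. y * ((sin x)\<^sup>2 / sqrt (?d y x)))) has_field_derivative
      4 / pi * (1 / 2 * gauss_int (sqrt (1 + h / 2)) 1)) (at h)"
    using h by (intro DERIV_cmult) (simp add: at_within_open[of h "{0<..}"] integral_unique)
  then have "((\<lambda>y. 4 / pi * integral {0..pi/2} (\<lambda>x. y * ((sin x)\<^sup>2 / sqrt (?d y x)))) has_field_derivative
      2 / pi * gauss_int (sqrt (1 + h / 2)) 1) (at h)" by simp
  then show ?thesis
    unfolding integral_mult_right
    by (rule has_field_derivative_transform_within_open[where S = "{0<..}"])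
       (use h in \<open>auto simp: pend_J_eq gauss_sin_int_def\<close>)
qed

section \<open>The theta constant on the real axis\<close>

definition theta :: "real \<Rightarrow> real" where
  "theta x = Re (theta4 (complex_of_real x))"

definition theta' :: "real \<Rightarrow> real" where
  "theta' x = Re (deriv theta4 (complex_of_real x))"

lemma theta_has_sum:
  assumes "\<bar>x\<bar> < 1"
  shows "((\<lambda>n::int. (-1) powi n * x ^ nat (n\<^sup>2)) has_sum theta x) UNIV"
    and theta4_of_real: "theta4 (complex_of_real x) = complex_of_real (theta x)"
proof -
  have "norm (complex_of_real x) < 1" using assms by simp
  note s = theta4_has_sum[OF this]
  have t: "(-1) powi n * complex_of_real x ^ nat (n\<^sup>2) = of_real ((-1) powi n * x ^ nat (n\<^sup>2))" for n
    by simp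
  show "((\<lambda>n::int. (-1) powi n * x ^ nat (n\<^sup>2)) has_sum theta x) UNIV"
    using has_sum_Re[OF s] unfolding t theta_def Re_complex_of_real .
  have "((\<lambda>n::int. 0::real) has_sum Im (theta4 (complex_of_real x))) UNIV"
    using has_sum_Im[OF s] unfolding t Im_complex_of_real .
  then have "Im (theta4 (complex_of_real x)) = 0"
    by (rule has_sum_unique) simp
  then show "theta4 (complex_of_real x) = complex_of_real (theta x)"
    by (simp add: theta_def complex_eq_iff)
qed

lemma theta_deriv:
  assumes "\<bar>x\<bar> < 1"
  shows "(theta has_real_derivative theta' x) (at x)"
    and deriv_theta4_of_real: "deriv theta4 (complex_of_real x) = complex_of_real (theta' x)"
proof -
  have "(theta4 has_field_derivative deriv theta4 (complex_of_real x)) (at (complex_of_real x))"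
    by (rule holomorphic_derivI[OF theta4_holomorphic]) (use assms in auto)
  then have v: "((\<lambda>x. theta4 (complex_of_real x)) has_vector_derivative deriv theta4 (complex_of_real x)) (at x)"
    by (rule has_vector_derivative_real_field)
  show "(theta has_real_derivative theta' x) (at x)"
    using has_field_derivative_Re[OF v] unfolding theta_def[abs_def] theta'_def .
  have "((\<lambda>x. 0::real) has_real_derivative Im (deriv theta4 (complex_of_real x))) (at x)"
    by (rule has_field_derivative_transform_within_open[OF has_field_derivative_Im[OF v], of "{-1<..<1}"])
       (use assms in \<open>auto simp: theta4_of_real\<close>)
  then have "Im (deriv theta4 (complex_of_real x)) = 0"
    by (rule DERIV_unique) simp
  then show "deriv theta4 (complex_of_real x) = complex_of_real (theta' x)"
    by (simp add: theta'_def complex_eq_iff)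
qed

lemma theta_0: "theta 0 = 1" "theta' 0 = -2"
  by (simp_all add: theta_def theta'_def theta4_0 deriv_theta4_0)

lemma isCont_theta: "\<bar>x\<bar> < 1 \<Longrightarrow> isCont theta x"
  by (rule DERIV_isCont[OF theta_deriv(1)])

lemma isCont_theta':
  assumes "\<bar>x\<bar> < 1"
  shows "isCont theta' x"
proof -
  have "continuous_on (ball 0 1) (deriv theta4)"
    by (intro holomorphic_on_imp_continuous_on holomorphic_deriv theta4_holomorphic) auto
  then have "isCont (deriv theta4) (complex_of_real x)"
    by (rule continuous_on_interior) (use assms in auto)
  then have "isCont (\<lambda>x. deriv theta4 (complex_of_real x)) x"
    by (rule isCont_o2[rotated]) (intro continuous_intros)
  then show ?thesis unfolding theta'_def[abs_def] by (intro isCont_Re)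
qed

lemma theta_duplication:
  assumes "\<bar>x\<bar> < 1"
  shows "(theta (-x))\<^sup>2 + (theta x)\<^sup>2 = 2 * (theta (- x\<^sup>2))\<^sup>2"
    and "theta (-x) * theta x = (theta (x\<^sup>2))\<^sup>2"
proof -
  have x2: "\<bar>x\<^sup>2\<bar> < 1" using assms by (simp add: abs_square_less_1)
  have n: "norm (complex_of_real x) < 1" using assms by simp
  have of: "theta4 (complex_of_real x) = of_real (theta x)"
    "theta4 (- complex_of_real x) = of_real (theta (-x))"
    "theta4 ((complex_of_real x)\<^sup>2) = of_real (theta (x\<^sup>2))"
    "theta4 (- (complex_of_real x)\<^sup>2) = of_real (theta (- x\<^sup>2))"
    using theta4_of_real[of x] theta4_of_real[of "-x"] theta4_of_real[of "x\<^sup>2"]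
      theta4_of_real[of "-x\<^sup>2"] assms x2 by simp_all
  have "complex_of_real ((theta (-x))\<^sup>2 + (theta x)\<^sup>2) = complex_of_real (2 * (theta (- x\<^sup>2))\<^sup>2)"
    using theta_sum_squares[OF n] unfolding of by simp
  then show "(theta (-x))\<^sup>2 + (theta x)\<^sup>2 = 2 * (theta (- x\<^sup>2))\<^sup>2"
    unfolding of_real_eq_iff .
  have "complex_of_real (theta (-x) * theta x) = complex_of_real ((theta (x\<^sup>2))\<^sup>2)"
    using theta_mult[OF n] unfolding of by simp
  then show "theta (-x) * theta x = (theta (x\<^sup>2))\<^sup>2"
    unfolding of_real_eq_iff .
qed

text \<open>Along \<open>x, x\<^sup>2, x\<^sup>4, \<dots>\<close> the function is constant while the argument tends to \<open>0\<close>. All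
  transcendental identities between theta functions and elliptic integrals below are reduced by
  this to duplication formulas and leading terms at \<open>0\<close>.\<close>

lemma square_invariant_eq_limit:
  fixes f :: "real \<Rightarrow> real"
  assumes inv: "\<And>x. 0 < x \<Longrightarrow> x < 1 \<Longrightarrow> f (x\<^sup>2) = f x"
    and lim: "(f \<longlongrightarrow> L) (at_right 0)" and x: "0 < x" "x < 1"
  shows "f x = L"
proof -
  have in01: "0 < x ^ (2 ^ n)" "x ^ (2 ^ n) < 1" for n
    using x by (auto simp: power_less_one_iff)
  have const: "f (x ^ (2 ^ n)) = f x" for n
  proof (induction n)
    case (Suc n)
    have "x ^ (2 ^ Suc n) = (x ^ (2 ^ n))\<^sup>2" by (simp add: power_mult power_commutes flip: power_mult)
    then show ?case using inv[OF in01] Suc by simp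
  qed simp
  have "(\<lambda>n. x ^ (2 ^ n)) \<longlonglongrightarrow> 0"
    using LIMSEQ_subseq_LIMSEQ[OF LIMSEQ_realpow_zero[of x], of "\<lambda>n. 2 ^ n"] x
    by (simp add: strict_mono_def o_def)
  then have "filterlim (\<lambda>n. x ^ (2 ^ n)) (at_right 0) sequentially"
    using in01(1) by (intro tendsto_imp_filterlim_at_right) auto
  from filterlim_compose[OF lim this] show ?thesis
    by (simp add: const LIMSEQ_const_iff)
qed

lemma theta_neg_ge_1:
  assumes "0 \<le> x" "x < 1"
  shows "theta (-x) \<ge> 1" and theta_diff: "theta x + 4 * x \<le> theta (-x)"
proof -
  have s: "((\<lambda>n::int. x ^ nat (n\<^sup>2)) has_sum theta (-x)) UNIV"
    using theta_has_sum(1)[of "-x"] assms by (simp add: theta3_terms)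
  have "(\<Sum>n\<in>{0::int}. x ^ nat (n\<^sup>2)) \<le> theta (-x)"
    by (rule finite_sum_le_has_sum[OF s]) (use assms in auto)
  then show "theta (-x) \<ge> 1" by simp
  have "((\<lambda>n::int. x ^ nat (n\<^sup>2) - (-1) powi n * x ^ nat (n\<^sup>2)) has_sum theta (-x) - theta x) UNIV"
    using has_sum_add[OF s has_sum_cmult_right[OF theta_has_sum(1), of x "-1"]] assms by simp
  then have "(\<Sum>n\<in>{1::int, -1}. x ^ nat (n\<^sup>2) - (-1) powi n * x ^ nat (n\<^sup>2)) \<le> theta (-x) - theta x"
    by (rule finite_sum_le_has_sum) (use assms in \<open>auto simp: power_int_minus_left\<close>)
  then show "theta x + 4 * x \<le> theta (-x)" by simp
qed

lemma theta_tendsto: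
  "(theta \<longlongrightarrow> 1) (at_right 0)" "((\<lambda>x. theta (-x)) \<longlongrightarrow> 1) (at_right 0)"
  "(theta' \<longlongrightarrow> -2) (at_right 0)" "((\<lambda>x. theta' (-x)) \<longlongrightarrow> -2) (at_right 0)"
proof -
  have "isCont theta 0" "isCont theta' 0" by (simp_all add: isCont_theta isCont_theta')
  moreover from this have "isCont (\<lambda>x. theta (-x)) 0" "isCont (\<lambda>x. theta' (-x)) 0"
    using isCont_o2[where f = uminus and a = "0::real" and g = theta]
      isCont_o2[where f = uminus and a = "0::real" and g = theta'] by simp_all
  ultimately show "(theta \<longlongrightarrow> 1) (at_right 0)" "((\<lambda>x. theta (-x)) \<longlongrightarrow> 1) (at_right 0)"
    "(theta' \<longlongrightarrow> -2) (at_right 0)" "((\<lambda>x. theta' (-x)) \<longlongrightarrow> -2) (at_right 0)"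
    unfolding isCont_def by (auto simp: theta_0 elim!: tendsto_within_subset)
qed

text \<open>The product formula shows that \<open>x\<close> is a zero if and only if \<open>x\<^sup>2\<close> is, so
  vanishing is invariant under squaring; near \<open>0\<close> there are no zeros.\<close>

lemma theta_pos:
  assumes "0 < x" "x < 1"
  shows "theta x > 0"
proof -
  have "(if theta x = 0 then 0 else 1::real) = 1"
  proof (rule square_invariant_eq_limit[OF _ _ assms, where f = "\<lambda>x. if theta x = 0 then 0 else 1"])
    fix y :: real assume y: "0 < y" "y < 1"
    have "theta (y\<^sup>2) = 0 \<longleftrightarrow> theta y = 0"
      using theta_duplication(2)[of y] theta_neg_ge_1(1)[of y] y by auto
    then show "(if theta (y\<^sup>2) = 0 then 0 else 1::real) = (if theta y = 0 then 0 else 1)" by simp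
  next
    have "eventually (\<lambda>x. theta x > 0) (at_right 0)"
      by (rule order_tendstoD(1)[OF theta_tendsto(1)]) simp
    then have "eventually (\<lambda>x. (if theta x = 0 then 0 else 1::real) = 1) (at_right 0)"
      by eventually_elim simp
    then show "((\<lambda>x. if theta x = 0 then 0 else 1::real) \<longlongrightarrow> 1) (at_right 0)"
      by (rule tendsto_eventually)
  qed
  then have "theta x \<noteq> 0" by (simp split: if_splits)
  moreover have "theta (-x) * theta x \<ge> 0"
    using theta_duplication(2)[of x] assms by simp
  ultimately show ?thesis
    using theta_neg_ge_1(1)[of x] assms by (simp add: zero_le_mult_iff)
qed

section \<open>Theta constants and the arithmetic-geometric mean\<close>

text \<open>The pair \<open>(\<theta>\<^sub>3\<^sup>2, \<theta>\<^sub>4\<^sup>2)\<close>, to which squaring the nome applies one step of the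
  arithmetic-geometric mean.\<close>

definition agm_a :: "real \<Rightarrow> real" where "agm_a x = (theta (-x))\<^sup>2"
definition agm_b :: "real \<Rightarrow> real" where "agm_b x = (theta x)\<^sup>2"
definition agm_a' :: "real \<Rightarrow> real" where "agm_a' x = - (2 * theta (-x) * theta' (-x))"
definition agm_b' :: "real \<Rightarrow> real" where "agm_b' x = 2 * theta x * theta' x"

lemma agm_order:
  assumes "0 < x" "x < 1"
  shows "0 < agm_b x" "agm_b x < agm_a x"
proof -
  have "0 < theta x" "theta x < theta (-x)"
    using theta_pos[OF assms] theta_neg_ge_1(2)[of x] assms by auto
  then show "0 < agm_b x" "agm_b x < agm_a x"
    by (simp_all add: agm_a_def agm_b_def power_strict_mono)
qed

lemma agm_deriv:
  assumes "\<bar>x\<bar> < 1"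
  shows "(agm_a has_real_derivative agm_a' x) (at x)" "(agm_b has_real_derivative agm_b' x) (at x)"
proof -
  have "((\<lambda>x. theta (-x)) has_real_derivative theta' (-x) * -1) (at x)"
    by (rule DERIV_chain2[OF theta_deriv(1)]) (use assms in \<open>auto intro!: derivative_eq_intros\<close>)
  from DERIV_power[OF this, of 2] show "(agm_a has_real_derivative agm_a' x) (at x)"
    unfolding agm_a_def[abs_def] agm_a'_def by (simp add: mult_ac)
  from DERIV_power[OF theta_deriv(1)[OF assms], of 2] show "(agm_b has_real_derivative agm_b' x) (at x)"
    unfolding agm_b_def[abs_def] agm_b'_def by (simp add: mult_ac)
qed

lemma agm_duplication:
  assumes "0 < x" "x < 1"
  shows "agm_a (x\<^sup>2) = (agm_a x + agm_b x) / 2" "(agm_b (x\<^sup>2))\<^sup>2 = agm_a x * agm_b x"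
    and "agm_b (x\<^sup>2) = sqrt (agm_a x * agm_b x)"
    and "4 * x * agm_a' (x\<^sup>2) = agm_a' x + agm_b' x"
    and "4 * x * (agm_b (x\<^sup>2) * agm_b' (x\<^sup>2)) = agm_a' x * agm_b x + agm_a x * agm_b' x"
proof -
  have a: "agm_a (y\<^sup>2) = (agm_a y + agm_b y) / 2" and b: "(agm_b (y\<^sup>2))\<^sup>2 = agm_a y * agm_b y"
    if "y \<in> {-1<..<1}" for y
  proof -
    from that have "\<bar>y\<bar> < 1" by auto
    note dup = theta_duplication[OF this]
    show "agm_a (y\<^sup>2) = (agm_a y + agm_b y) / 2" using dup(1) by (simp add: agm_a_def agm_b_def)
    show "(agm_b (y\<^sup>2))\<^sup>2 = agm_a y * agm_b y"
      unfolding agm_a_def agm_b_def power_mult_distrib[symmetric] dup(2) ..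
  qed
  show "agm_a (x\<^sup>2) = (agm_a x + agm_b x) / 2" "(agm_b (x\<^sup>2))\<^sup>2 = agm_a x * agm_b x"
    using a[of x] b[of x] assms by auto
  moreover have "agm_b (x\<^sup>2) \<ge> 0" by (simp add: agm_b_def)
  ultimately show "agm_b (x\<^sup>2) = sqrt (agm_a x * agm_b x)"
    by (metis real_sqrt_unique)
  have x2: "\<bar>x\<^sup>2\<bar> < 1" "\<bar>x\<bar> < 1" using assms by (simp_all add: abs_square_less_1)
  have sq: "((\<lambda>x. x\<^sup>2) has_real_derivative 2 * x) (at x)"
    by (auto intro!: derivative_eq_intros)
  have "((\<lambda>x. agm_a (x\<^sup>2)) has_real_derivative agm_a' (x\<^sup>2) * (2 * x)) (at x)"
    by (rule DERIV_chain2[OF agm_deriv(1)[OF x2(1)] sq])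
  moreover have "((\<lambda>x. agm_a (x\<^sup>2)) has_real_derivative (agm_a' x + agm_b' x) / 2) (at x)"
    by (rule has_field_derivative_transform_within_open[where S = "{-1<..<1}",
          OF DERIV_cdivide[OF DERIV_add[OF agm_deriv[OF x2(2)]], of 2]])
       (use assms a in auto)
  ultimately have "agm_a' (x\<^sup>2) * (2 * x) = (agm_a' x + agm_b' x) / 2"
    by (rule DERIV_unique)
  then show "4 * x * agm_a' (x\<^sup>2) = agm_a' x + agm_b' x" by (simp add: mult_ac)
  have "((\<lambda>x. (agm_b (x\<^sup>2))\<^sup>2) has_real_derivative 2 * agm_b (x\<^sup>2) * (agm_b' (x\<^sup>2) * (2 * x))) (at x)"
    using DERIV_power[OF DERIV_chain2[OF agm_deriv(2)[OF x2(1)] sq], of 2] by (simp add: mult_ac)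
  moreover have "((\<lambda>x. (agm_b (x\<^sup>2))\<^sup>2) has_real_derivative agm_a' x * agm_b x + agm_b' x * agm_a x) (at x)"
    by (rule has_field_derivative_transform_within_open[where S = "{-1<..<1}",
          OF DERIV_mult[OF agm_deriv[OF x2(2)]]])
       (use assms b in auto)
  ultimately have "2 * agm_b (x\<^sup>2) * (agm_b' (x\<^sup>2) * (2 * x)) = agm_a' x * agm_b x + agm_b' x * agm_a x"
    by (rule DERIV_unique)
  then show "4 * x * (agm_b (x\<^sup>2) * agm_b' (x\<^sup>2)) = agm_a' x * agm_b x + agm_a x * agm_b' x"
    by (simp add: mult_ac)
qed

lemma agm_duplication_diff:
  assumes "0 < x" "x < 1"
  shows "(agm_a (x\<^sup>2))\<^sup>2 - (agm_b (x\<^sup>2))\<^sup>2 = ((agm_a x - agm_b x) / 2)\<^sup>2"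
  unfolding agm_duplication(1)[OF assms] agm_duplication(2)[OF assms]
  by (simp add: power2_eq_square field_simps)

lemma agm_tendsto:
  "(agm_a \<longlongrightarrow> 1) (at_right 0)" "(agm_b \<longlongrightarrow> 1) (at_right 0)"
  "(agm_a' \<longlongrightarrow> 4) (at_right 0)" "(agm_b' \<longlongrightarrow> -4) (at_right 0)"
  "((\<lambda>x. ((agm_a x)\<^sup>2 - (agm_b x)\<^sup>2) / x) \<longlongrightarrow> 16) (at_right 0)"
proof -
  show "(agm_a \<longlongrightarrow> 1) (at_right 0)" "(agm_b \<longlongrightarrow> 1) (at_right 0)"
    unfolding agm_a_def[abs_def] agm_b_def[abs_def]
    by (rule tendsto_eq_intros theta_tendsto | simp)+
  show "(agm_a' \<longlongrightarrow> 4) (at_right 0)" "(agm_b' \<longlongrightarrow> -4) (at_right 0)"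
    unfolding agm_a'_def[abs_def] agm_b'_def[abs_def]
    by (rule tendsto_eq_intros theta_tendsto | simp)+
  have v: "agm_a 0 = 1" "agm_b 0 = 1" "agm_a' 0 = 4" "agm_b' 0 = -4"
    by (simp_all add: agm_a_def agm_b_def agm_a'_def agm_b'_def theta_0)
  have "((\<lambda>x. (agm_a x)\<^sup>2 - (agm_b x)\<^sup>2) has_real_derivative 16) (at 0)"
    using DERIV_diff[OF DERIV_power[OF agm_deriv(1)] DERIV_power[OF agm_deriv(2)], of 0 2 2]
    by (simp add: v)
  then have "((\<lambda>x. ((agm_a x)\<^sup>2 - (agm_b x)\<^sup>2) / x) \<longlongrightarrow> 16) (at 0)"
    by (simp add: DERIV_def agm_a_def agm_b_def theta_0)
  then show "((\<lambda>x. ((agm_a x)\<^sup>2 - (agm_b x)\<^sup>2) / x) \<longlongrightarrow> 16) (at_right 0)"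
    by (rule tendsto_within_subset) auto
qed

section \<open>Evaluation of the integrals at theta constants\<close>

lemma eventually_01: "eventually (\<lambda>x::real. 0 < x \<and> x < 1) (at_right 0)"
  using eventually_at_right_real[of 0 1] by simp

text \<open>Gauss: the integral is unchanged by a step of the arithmetic-geometric mean, and
  \<open>(agm_a x, agm_b x)\<close> tends to \<open>(1, 1)\<close>, where the integral is \<open>pi / 2\<close>.\<close>

lemma gauss_int_theta:
  assumes "0 < x" "x < 1"
  shows "gauss_int (agm_a x) (agm_b x) = pi / 2"
proof (rule square_invariant_eq_limit[OF _ _ assms, where f = "\<lambda>x. gauss_int (agm_a x) (agm_b x)"])
  fix y :: real assume y: "0 < y" "y < 1"
  show "gauss_int (agm_a (y\<^sup>2)) (agm_b (y\<^sup>2)) = gauss_int (agm_a y) (agm_b y)"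
    unfolding agm_duplication(1)[OF y] agm_duplication(3)[OF y]
    by (rule gauss_int_agm) (use agm_order[OF y] in auto)
next
  show "((\<lambda>x. gauss_int (agm_a x) (agm_b x)) \<longlongrightarrow> pi / 2) (at_right 0)"
  proof (rule tendsto_sandwich)
    show "eventually (\<lambda>x. pi / (2 * agm_a x) \<le> gauss_int (agm_a x) (agm_b x)) (at_right 0)"
      using eventually_01
      by eventually_elim (rule gauss_int_bounds(1)[OF agm_order(1) less_imp_le[OF agm_order(2)]]; simp)
    show "eventually (\<lambda>x. gauss_int (agm_a x) (agm_b x) \<le> pi / (2 * agm_b x)) (at_right 0)"
      using eventually_01
      by eventually_elim (rule gauss_int_bounds(2)[OF agm_order(1) less_imp_le[OF agm_order(2)]]; simp)
    show "((\<lambda>x. pi / (2 * agm_a x)) \<longlongrightarrow> pi / 2) (at_right 0)"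
      "((\<lambda>x. pi / (2 * agm_b x)) \<longlongrightarrow> pi / 2) (at_right 0)"
      by (rule tendsto_eq_intros agm_tendsto | simp)+
  qed
qed

lemma inverse_ln_tendsto: "((\<lambda>x::real. 1 / ln x) \<longlongrightarrow> 0) (at_right 0)"
  by real_asymp

text \<open>Let \<open>c\<^sup>2 = a\<^sup>2 - b\<^sup>2\<close>. After squaring the nome, \<open>(a, c)\<close> becomes a pair whose means are
  \<open>(a / 2, c / 2)\<close>, so the complementary integral doubles, exactly as \<open>ln x\<close> does. Their quotient is
  therefore invariant, and its limit follows from the logarithmic asymptotics together with
  \<open>c\<^sup>2 \<sim> 16 x\<close>. This identifies the nome as \<open>exp (- pi K' / K)\<close> without the modular transformation
  of the theta function.\<close>

lemma gauss_int_theta_nome: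
  assumes "0 < x" "x < 1"
  shows "gauss_int (agm_a x) (sqrt ((agm_a x)\<^sup>2 - (agm_b x)\<^sup>2)) = - ln x / 2"
proof -
  define c where "c = (\<lambda>x. sqrt ((agm_a x)\<^sup>2 - (agm_b x)\<^sup>2))"
  define F where "F = (\<lambda>x. gauss_int (agm_a x) (c x))"
  have pos: "agm_a x > 0" "agm_b x > 0" "c x > 0" if "0 < x" "x < 1" for x
    using agm_order[OF that] by (auto simp: c_def power_strict_mono)
  have "F x / ln x = - 1 / 2"
  proof (rule square_invariant_eq_limit[OF _ _ assms, where f = "\<lambda>x. F x / ln x"])
    fix y :: real assume y: "0 < y" "y < 1"
    have y2: "0 < y\<^sup>2" "y\<^sup>2 < 1" using y by (auto simp: power_less_one_iff)
    have c2: "c (y\<^sup>2) = (agm_a y - agm_b y) / 2"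
      unfolding c_def agm_duplication_diff[OF y] using agm_order[OF y] by simp
    have "F (y\<^sup>2) = gauss_int ((agm_a (y\<^sup>2) + c (y\<^sup>2)) / 2) (sqrt (agm_a (y\<^sup>2) * c (y\<^sup>2)))"
      unfolding F_def by (rule gauss_int_agm[symmetric]) (use pos[OF y2] in auto)
    also have "(agm_a (y\<^sup>2) + c (y\<^sup>2)) / 2 = 1 / 2 * agm_a y"
      unfolding c2 agm_duplication(1)[OF y] by (simp add: field_simps)
    also have "sqrt (agm_a (y\<^sup>2) * c (y\<^sup>2)) = 1 / 2 * c y"
    proof -
      have "agm_a (y\<^sup>2) * c (y\<^sup>2) = ((agm_a y)\<^sup>2 - (agm_b y)\<^sup>2) / 2\<^sup>2"
        unfolding c2 agm_duplication(1)[OF y] by (simp add: power2_eq_square algebra_simps)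
      then have "sqrt (agm_a (y\<^sup>2) * c (y\<^sup>2)) = sqrt (((agm_a y)\<^sup>2 - (agm_b y)\<^sup>2) / 2\<^sup>2)"
        by (simp only:)
      also have "\<dots> = 1 / 2 * c y" by (simp add: c_def real_sqrt_divide)
      finally show ?thesis .
    qed
    also have "gauss_int (1 / 2 * agm_a y) (1 / 2 * c y) = 2 * F y"
      by (subst gauss_int_scale(1)) (simp_all add: F_def)
    finally show "F (y\<^sup>2) / ln (y\<^sup>2) = F y / ln y"
      using y by (simp add: ln_realpow)
  next
    let ?l = "\<lambda>x. arsinh (agm_b x / c x) / agm_b x"
    have "((\<lambda>x. (ln (agm_a x + agm_b x) - ln (((agm_a x)\<^sup>2 - (agm_b x)\<^sup>2) / x) / 2) / agm_b x * (1 / ln x)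
             - 1 / (2 * agm_b x)) \<longlongrightarrow> (ln 2 - ln 16 / 2) * 0 - 1 / 2) (at_right 0)"
      by (rule tendsto_eq_intros agm_tendsto inverse_ln_tendsto refl | simp)+
    moreover have "eventually (\<lambda>x. (ln (agm_a x + agm_b x) - ln (((agm_a x)\<^sup>2 - (agm_b x)\<^sup>2) / x) / 2) / agm_b x * (1 / ln x)
             - 1 / (2 * agm_b x) = ?l x / ln x) (at_right 0)"
      using eventually_01
    proof eventually_elim
      case (elim y)
      then have y: "0 < y" "y < 1" by auto
      note p = pos[OF y]
      have d: "(agm_a y)\<^sup>2 - (agm_b y)\<^sup>2 > 0" using agm_order[OF y] by (simp add: power_strict_mono)
      have c2: "(c y)\<^sup>2 = (agm_a y)\<^sup>2 - (agm_b y)\<^sup>2" using d by (simp add: c_def)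
      have "sqrt ((agm_b y / c y)\<^sup>2 + 1) = sqrt ((agm_a y / c y)\<^sup>2)"
        using p c2 by (simp add: power_divide field_simps)
      also have "\<dots> = agm_a y / c y" using p by simp
      finally have "arsinh (agm_b y / c y) = ln (agm_b y / c y + agm_a y / c y)"
        by (simp add: arsinh_real_def)
      also have "\<dots> = ln ((agm_a y + agm_b y) / c y)" by (simp add: add_divide_distrib add.commute)
      also have "\<dots> = ln (agm_a y + agm_b y) - ln ((agm_a y)\<^sup>2 - (agm_b y)\<^sup>2) / 2"
      proof -
        have "ln (c y) = ln ((agm_a y)\<^sup>2 - (agm_b y)\<^sup>2) / 2"
          unfolding c_def by (rule ln_sqrt[OF less_imp_le[OF d]])
        then show ?thesis using p by (simp add: ln_div)
      qed
      also have "ln ((agm_a y)\<^sup>2 - (agm_b y)\<^sup>2) = ln (((agm_a y)\<^sup>2 - (agm_b y)\<^sup>2) / y) + ln y"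
        using d y by (simp add: ln_div)
      finally have e: "arsinh (agm_b y / c y)
        = ln (agm_a y + agm_b y) - (ln (((agm_a y)\<^sup>2 - (agm_b y)\<^sup>2) / y) + ln y) / 2" .
      have "ln y \<noteq> 0" using y by simp
      then have "(u - v / 2) / w * (1 / ln y) - 1 / (2 * w) = (u - (v + ln y) / 2) / w / ln y"
        if "w > 0" for u v w
        using that by (simp add: field_simps)
      from this[OF p(2)] show ?case unfolding e .
    qed
    ultimately have "((\<lambda>x. ?l x / ln x) \<longlongrightarrow> (ln 2 - ln 16 / 2) * 0 - 1 / 2) (at_right 0)"
      by (rule Lim_transform_eventually)
    then have l: "((\<lambda>x. ?l x / ln x) \<longlongrightarrow> - 1 / 2) (at_right 0)" by simp
    have "((\<lambda>x. (F x - ?l x) * (1 / ln x)) \<longlongrightarrow> 0) (at_right 0)"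
    proof (rule lim_null_mult_left_bounded[OF _ inverse_ln_tendsto])
      have "eventually (\<lambda>x. agm_b x > 1 / 2) (at_right 0)"
        by (rule order_tendstoD(1)[OF agm_tendsto(2)]) simp
      with eventually_01 show "eventually (\<lambda>x. norm (F x - ?l x) \<le> pi) (at_right 0)"
      proof eventually_elim
        case (elim y)
        then have y: "0 < y" "y < 1" by auto
        note p = pos[OF y]
        have "(agm_a y)\<^sup>2 - (agm_b y)\<^sup>2 > 0" using agm_order[OF y] by (simp add: power_strict_mono)
        then have "(c y)\<^sup>2 = (agm_a y)\<^sup>2 - (agm_b y)\<^sup>2" by (simp add: c_def)
        then have "agm_a y = sqrt ((agm_b y)\<^sup>2 + (c y)\<^sup>2)" using p by simp
        note b = gauss_int_log_bounds[OF p(2,3) this, folded F_def]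
        have "pi / (2 * agm_b y) \<le> pi / 1"
          using elim by (intro divide_left_mono) auto
        then show ?case using b by (simp add: F_def)
      qed
    qed
    from tendsto_add[OF l this] show "((\<lambda>x. F x / ln x) \<longlongrightarrow> - 1 / 2) (at_right 0)"
      by (simp add: diff_divide_distrib)
  qed
  then show ?thesis using assms by (simp add: F_def c_def field_simps)
qed

text \<open>Dividing by \<open>a b\<close> gives \<open>2 x (ln (a / b))' = a\<^sup>2 - b\<^sup>2\<close>. The quotient of the two sides is
  invariant under squaring of the nome, because each of them is multiplied by
  \<open>(a - b) / (4 (a + b))\<close>, and at \<open>0\<close> both sides behave like \<open>16 x\<close>.\<close>

lemma agm_log_deriv:
  assumes "0 < x" "x < 1"
  shows "2 * x * (agm_a' x * agm_b x - agm_a x * agm_b' x)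
       = agm_a x * agm_b x * ((agm_a x)\<^sup>2 - (agm_b x)\<^sup>2)"
proof -
  define f where "f = (\<lambda>x. x * (agm_a' x * agm_b x - agm_a x * agm_b' x)
      / (agm_a x * agm_b x * ((agm_a x)\<^sup>2 - (agm_b x)\<^sup>2)))"
  have d: "(agm_a y)\<^sup>2 - (agm_b y)\<^sup>2 > 0" if "0 < y" "y < 1" for y
    using agm_order[OF that] by (simp add: power_strict_mono)
  have "f x = 1 / 2"
  proof (rule square_invariant_eq_limit[OF _ _ assms])
    fix y :: real assume y: "0 < y" "y < 1"
    define a b a' b' where "a = agm_a y" and "b = agm_b y" and "a' = agm_a' y" and "b' = agm_b' y"
    define A B A' B' where "A = agm_a (y\<^sup>2)" and "B = agm_b (y\<^sup>2)" and "A' = agm_a' (y\<^sup>2)" and "B' = agm_b' (y\<^sup>2)"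
    have ab: "b > 0" "a > b" using agm_order[OF y] by (simp_all add: a_def b_def)
    have y2: "0 < y\<^sup>2" "y\<^sup>2 < 1" using y by (auto simp: power_less_one_iff)
    have AB: "B > 0" "A > B" using agm_order[OF y2] by (simp_all add: A_def B_def)
    have A: "A = (a + b) / 2" and B: "B\<^sup>2 = a * b" and A': "4 * y * A' = a' + b'"
      and B': "4 * y * (B * B') = a' * b + a * b'"
      and D: "A\<^sup>2 - B\<^sup>2 = ((a - b) / 2)\<^sup>2"
      using agm_duplication[OF y] agm_duplication_diff[OF y]
      by (simp_all add: a_def b_def a'_def b'_def A_def B_def A'_def B'_def)
    have num: "8 * (y * (B * (A' * B - A * B'))) = (a - b) * (a' * b - a * b')"
    proof -
      have "8 * (y * (B * (A' * B - A * B'))) = 2 * (4 * y * A') * B\<^sup>2 - 2 * A * (4 * y * (B * B'))"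
        by (simp add: power2_eq_square algebra_simps)
      also have "\<dots> = (a - b) * (a' * b - a * b')"
        unfolding A' B B' A by (simp add: algebra_simps)
      finally show ?thesis .
    qed
    have den: "8 * (B * (A * B * (A\<^sup>2 - B\<^sup>2))) = (a - b) * (a * b * (a\<^sup>2 - b\<^sup>2))"
    proof -
      have "8 * (B * (A * B * (A\<^sup>2 - B\<^sup>2))) = 8 * (A * B\<^sup>2 * (A\<^sup>2 - B\<^sup>2))"
        by (simp add: power2_eq_square algebra_simps)
      also have "\<dots> = (a - b) * (a * b * (a\<^sup>2 - b\<^sup>2))"
        unfolding D unfolding B A by (simp add: power2_eq_square field_simps)
      finally show ?thesis .
    qed
    have "f (y\<^sup>2) = (8 * B * y\<^sup>2 * (A' * B - A * B')) / (8 * B * (A * B * (A\<^sup>2 - B\<^sup>2)))"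
      using AB by (simp add: f_def A_def B_def A'_def B'_def)
    also have "\<dots> = (y * (8 * (y * (B * (A' * B - A * B'))))) / (8 * (B * (A * B * (A\<^sup>2 - B\<^sup>2))))"
      by (simp add: power2_eq_square mult_ac)
    also have "\<dots> = ((a - b) * (y * (a' * b - a * b'))) / ((a - b) * (a * b * (a\<^sup>2 - b\<^sup>2)))"
      unfolding num den by (simp only: mult_ac)
    also have "\<dots> = f y"
      using ab by (simp add: f_def a_def b_def a'_def b'_def)
    finally show "f (y\<^sup>2) = f y" .
  next
    have "((\<lambda>x. (agm_a' x * agm_b x - agm_a x * agm_b' x)
      / (agm_a x * agm_b x * (((agm_a x)\<^sup>2 - (agm_b x)\<^sup>2) / x))) \<longlongrightarrow> 1 / 2) (at_right 0)"
      by (rule tendsto_eq_intros agm_tendsto refl | simp)+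
    moreover have "eventually (\<lambda>x. (agm_a' x * agm_b x - agm_a x * agm_b' x)
      / (agm_a x * agm_b x * (((agm_a x)\<^sup>2 - (agm_b x)\<^sup>2) / x)) = f x) (at_right 0)"
      using eventually_01 by eventually_elim (simp add: f_def mult.commute)
    ultimately show "(f \<longlongrightarrow> 1 / 2) (at_right 0)"
      by (rule Lim_transform_eventually)
  qed
  then show ?thesis
    using agm_order[OF assms] d[OF assms] by (simp add: f_def field_simps)
qed

text \<open>Write the claim as \<open>T = U\<close> with \<open>T = (2 / pi) (a\<^sup>2 - b\<^sup>2) gauss_sin_int a b\<close> and
  \<open>U = - 2 x b' / b\<close>. Under squaring of the nome both are halved and lowered by \<open>(a\<^sup>2 - b\<^sup>2) / 4\<close>, so
  \<open>T - U\<close> is halved. Multiplication by \<open>ln x\<close>, which doubles, yields an invariant function, and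
  its limit at \<open>0\<close> is \<open>0\<close> since \<open>T\<close> and \<open>U\<close> are of order \<open>x\<close>.\<close>

lemma gauss_sin_int_theta:
  assumes "0 < x" "x < 1"
  shows "((agm_a x)\<^sup>2 - (agm_b x)\<^sup>2) * gauss_sin_int (agm_a x) (agm_b x) = - (pi * x * agm_b' x / agm_b x)"
proof -
  define T where "T = (\<lambda>x. 2 / pi * (((agm_a x)\<^sup>2 - (agm_b x)\<^sup>2) * gauss_sin_int (agm_a x) (agm_b x)))"
  define U where "U = (\<lambda>x. - (2 * x * agm_b' x / agm_b x))"
  have "(T x - U x) * ln x = 0"
  proof (rule square_invariant_eq_limit[OF _ _ assms, where f = "\<lambda>x. (T x - U x) * ln x"])
    fix y :: real assume y: "0 < y" "y < 1"
    have pos: "agm_a y > 0" "agm_b y > 0" using agm_order[OF y] by auto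
    define s where "s = gauss_sin_int (agm_a y) (agm_b y)"
    define d where "d = (agm_a y)\<^sup>2 - (agm_b y)\<^sup>2"
    have "T (y\<^sup>2) = 2 / pi * (((agm_a y - agm_b y) / 2)\<^sup>2 *
        gauss_sin_int ((agm_a y + agm_b y) / 2) (sqrt (agm_a y * agm_b y)))"
      unfolding T_def agm_duplication_diff[OF y]
      unfolding agm_duplication(1)[OF y] agm_duplication(3)[OF y] ..
    also have "\<dots> = 2 / pi / 4 * ((agm_a y - agm_b y)\<^sup>2 *
        gauss_sin_int ((agm_a y + agm_b y) / 2) (sqrt (agm_a y * agm_b y)))"
      by (simp add: power_divide)
    also have "\<dots> = 2 / pi / 4 * (d * (2 * s - pi / 2))"
      unfolding gauss_sin_int_agm[OF pos] gauss_int_theta[OF y] s_def d_def ..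
    also have "\<dots> = 1 / 2 * T y - d / 4"
      unfolding T_def s_def[symmetric] d_def[symmetric] by (simp add: field_simps)
    finally have T2: "T (y\<^sup>2) = 1 / 2 * T y - d / 4" .
    have "agm_b (y\<^sup>2) > 0" by (rule agm_order(1)) (use y in \<open>auto simp: power_less_one_iff\<close>)
    then have "U (y\<^sup>2) = - (y / 2 * (4 * y * (agm_b (y\<^sup>2) * agm_b' (y\<^sup>2))) / (agm_b (y\<^sup>2))\<^sup>2)"
      by (simp add: U_def power2_eq_square)
    also have "\<dots> = - (y / 2 * (agm_a' y * agm_b y + agm_a y * agm_b' y) / (agm_a y * agm_b y))"
      unfolding agm_duplication(2,5)[OF y] ..
    also have "\<dots> = 1 / 2 * U y - (2 * y * (agm_a' y * agm_b y - agm_a y * agm_b' y)) / (4 * agm_a y * agm_b y)"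
      unfolding U_def using pos by (simp add: field_simps)
    also have "\<dots> = 1 / 2 * U y - d / 4"
      unfolding agm_log_deriv[OF y] d_def using pos by simp
    finally have U2: "U (y\<^sup>2) = 1 / 2 * U y - d / 4" .
    show "(T (y\<^sup>2) - U (y\<^sup>2)) * ln (y\<^sup>2) = (T y - U y) * ln y"
      unfolding T2 U2 using y by (simp add: ln_realpow field_simps)
  next
    have xln: "((\<lambda>x::real. x * ln x) \<longlongrightarrow> 0) (at_right 0)" by real_asymp
    have "((\<lambda>x. 2 / pi * (((agm_a x)\<^sup>2 - (agm_b x)\<^sup>2) / x * (x * ln x))) \<longlongrightarrow> 2 / pi * (16 * 0)) (at_right 0)"
      by (intro tendsto_mult tendsto_const agm_tendsto xln)
    then have Z: "((\<lambda>x. 2 / pi * (((agm_a x)\<^sup>2 - (agm_b x)\<^sup>2) / x * (x * ln x))) \<longlongrightarrow> 0) (at_right 0)"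
      by (simp only: mult_zero_right)
    have "((\<lambda>x. 2 / pi * (((agm_a x)\<^sup>2 - (agm_b x)\<^sup>2) / x * (x * ln x)) * gauss_sin_int (agm_a x) (agm_b x)) \<longlongrightarrow> 0) (at_right 0)"
    proof (rule lim_null_mult_right_bounded[OF Z])
      have "eventually (\<lambda>x. agm_b x > 1 / 2) (at_right 0)"
        by (rule order_tendstoD(1)[OF agm_tendsto(2)]) simp
      with eventually_01 show "eventually (\<lambda>x. norm (gauss_sin_int (agm_a x) (agm_b x)) \<le> pi) (at_right 0)"
      proof eventually_elim
        case (elim y)
        then have y: "0 < y" "y < 1" by auto
        have "agm_b y \<le> agm_a y" using agm_order[OF y] by simp
        note b = gauss_int_bounds(3,4)[OF agm_order(1)[OF y] this]
        have "pi / (2 * agm_b y) \<le> pi / 1"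
          using elim by (intro divide_left_mono) auto
        then show ?case using b by simp
      qed
    qed
    moreover have "((\<lambda>x. - (2 * agm_b' x / agm_b x) * (x * ln x)) \<longlongrightarrow> - (2 * (-4) / 1) * 0) (at_right 0)"
      by (intro tendsto_intros agm_tendsto xln) simp
    ultimately have "((\<lambda>x. 2 / pi * (((agm_a x)\<^sup>2 - (agm_b x)\<^sup>2) / x * (x * ln x)) * gauss_sin_int (agm_a x) (agm_b x)
        - (- (2 * agm_b' x / agm_b x) * (x * ln x))) \<longlongrightarrow> 0 - - (2 * (-4) / 1) * 0) (at_right 0)"
      by (rule tendsto_diff)
    moreover have "eventually (\<lambda>x. 2 / pi * (((agm_a x)\<^sup>2 - (agm_b x)\<^sup>2) / x * (x * ln x)) * gauss_sin_int (agm_a x) (agm_b x)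
        - (- (2 * agm_b' x / agm_b x) * (x * ln x)) = (T x - U x) * ln x) (at_right 0)"
    proof -
      have alg: "2 / pi * (D / z * (z * L)) * G - (- (2 * e / b) * (z * L)) = (2 / pi * (D * G) - - (2 * z * e / b)) * L"
        if "z \<noteq> 0" for D z L G e b :: real
        using that by (simp add: algebra_simps)
      from eventually_01 show ?thesis
        unfolding T_def U_def by (rule eventually_mono) (rule alg, simp)
    qed
    ultimately have "((\<lambda>x. (T x - U x) * ln x) \<longlongrightarrow> 0 - - (2 * (-4) / 1) * 0) (at_right 0)"
      by (rule Lim_transform_eventually)
    then show "((\<lambda>x. (T x - U x) * ln x) \<longlongrightarrow> 0) (at_right 0)" by simp
  qed
  then have "T x = U x" using assms by simp
  have "((agm_a x)\<^sup>2 - (agm_b x)\<^sup>2) * gauss_sin_int (agm_a x) (agm_b x) = pi / 2 * T x"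
    by (simp add: T_def)
  also have "\<dots> = - (pi * x * agm_b' x / agm_b x)"
    unfolding \<open>T x = U x\<close> by (simp add: U_def)
  finally show ?thesis .
qed

section \<open>The nome as a parameter for the energy\<close>

text \<open>The energy with complementary modulus \<open>k'\<^sup>2 = 1 - \<theta>\<^sub>4\<^sup>4 / \<theta>\<^sub>3\<^sup>4\<close>, that is, the energy whose
  nome is \<open>x\<close>.\<close>

definition energy :: "real \<Rightarrow> real" where
  "energy x = 2 * ((agm_a x)\<^sup>2 - (agm_b x)\<^sup>2) / (agm_b x)\<^sup>2"

lemma energy_pos: "0 < x \<Longrightarrow> x < 1 \<Longrightarrow> energy x > 0"
  using agm_order[of x] by (simp add: energy_def power_strict_mono)

lemma energy_sqrt:
  assumes "0 < x" "x < 1"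
  shows "sqrt (1 + energy x / 2) = 1 / agm_b x * agm_a x"
    and "sqrt (energy x / 2) = 1 / agm_b x * sqrt ((agm_a x)\<^sup>2 - (agm_b x)\<^sup>2)"
proof -
  note p = agm_order[OF assms]
  have "1 + energy x / 2 = (agm_a x / agm_b x)\<^sup>2"
    using p by (simp add: energy_def power_divide field_simps)
  then show "sqrt (1 + energy x / 2) = 1 / agm_b x * agm_a x" using p by simp
  have "energy x / 2 = ((agm_a x)\<^sup>2 - (agm_b x)\<^sup>2) / (agm_b x)\<^sup>2"
    by (simp add: energy_def diff_divide_distrib)
  then have "sqrt (energy x / 2) = sqrt (((agm_a x)\<^sup>2 - (agm_b x)\<^sup>2) / (agm_b x)\<^sup>2)"
    by (simp only:)
  also have "\<dots> = 1 / agm_b x * sqrt ((agm_a x)\<^sup>2 - (agm_b x)\<^sup>2)"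
    using p by (simp add: real_sqrt_divide)
  finally show "sqrt (energy x / 2) = 1 / agm_b x * sqrt ((agm_a x)\<^sup>2 - (agm_b x)\<^sup>2)" .
qed

text \<open>Up to a common factor, \<open>dI / dh\<close> is the complementary integral \<open>- ln x / 2\<close> and \<open>dJ / dh\<close> is
  twice the integral with value \<open>pi / 2\<close>.\<close>

lemma pend_dI_dJ_energy:
  assumes "0 < x" "x < 1"
  shows "exp (- 2 * pi * pend_dI_dJ (energy x)) = x"
proof -
  note p = agm_order[OF assms]
  note h = energy_pos[OF assms]
  have one: "1 = 1 / agm_b x * agm_b x" using p by simp
  have "deriv pend_I (energy x) = 1 / pi * (agm_b x * (- ln x / 2))"
  proof -
    have "deriv pend_I (energy x) = 1 / pi * gauss_int (sqrt (1 + energy x / 2)) (sqrt (energy x / 2))"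
      by (rule DERIV_imp_deriv[OF pend_I_deriv[OF h]])
    also have "\<dots> = 1 / pi * (agm_b x * (- ln x / 2))"
      unfolding energy_sqrt[OF assms] using p
      by (subst gauss_int_scale(1)) (simp_all add: gauss_int_theta_nome[OF assms])
    finally show ?thesis .
  qed
  moreover have "deriv pend_J (energy x) = 2 / pi * (agm_b x * (pi / 2))"
  proof -
    have "deriv pend_J (energy x) = 2 / pi * gauss_int (sqrt (1 + energy x / 2)) 1"
      by (rule DERIV_imp_deriv[OF pend_J_deriv[OF h]])
    also have "\<dots> = 2 / pi * gauss_int (1 / agm_b x * agm_a x) (1 / agm_b x * agm_b x)"
      unfolding energy_sqrt[OF assms] one[symmetric] ..
    also have "\<dots> = 2 / pi * (agm_b x * (pi / 2))"
      using p by (subst gauss_int_scale(1)) (simp_all add: gauss_int_theta[OF assms])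
    finally show ?thesis .
  qed
  ultimately have "- 2 * pi * pend_dI_dJ (energy x) = ln x"
    using p by (simp add: pend_dI_dJ_def)
  then show ?thesis using assms by simp
qed

lemma pend_J_energy:
  assumes "0 < x" "x < 1"
  shows "pend_J (energy x) = - 16 * x * theta' x / theta x ^ 3"
proof -
  note p = agm_order[OF assms] and t = theta_pos[OF assms]
  have one: "1 = 1 / agm_b x * agm_b x" using p by simp
  have "pend_J (energy x) = 4 * energy x / pi * gauss_sin_int (sqrt (1 + energy x / 2)) 1"
    by (rule pend_J_eq[OF energy_pos[OF assms]])
  also have "\<dots> = 4 * energy x / pi * gauss_sin_int (1 / agm_b x * agm_a x) (1 / agm_b x * agm_b x)"
    unfolding energy_sqrt[OF assms] one[symmetric] ..
  also have "\<dots> = 4 * energy x / pi * (agm_b x * gauss_sin_int (agm_a x) (agm_b x))"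
    using p by (subst gauss_int_scale(2)) simp_all
  also have "\<dots> = 8 / (pi * agm_b x) * (((agm_a x)\<^sup>2 - (agm_b x)\<^sup>2) * gauss_sin_int (agm_a x) (agm_b x))"
  proof -
    have "4 * (2 * d / b\<^sup>2) / pi * (b * s) = 8 / (pi * b) * (d * s)" if "b > 0" for b d s :: real
      using that by (simp add: power2_eq_square)
    from this[OF p(1)] show ?thesis unfolding energy_def .
  qed
  also have "\<dots> = - (8 * x * agm_b' x / (agm_b x)\<^sup>2)"
    unfolding gauss_sin_int_theta[OF assms] using p by (simp add: power2_eq_square)
  also have "\<dots> = - 16 * x * theta' x / theta x ^ 3"
    using t by (simp add: agm_b'_def agm_b_def power2_eq_square power3_eq_cube)
  finally show ?thesis .
qed

lemma pend_J_strict_mono: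
  assumes "0 < g" "g < h"
  shows "pend_J g < pend_J h"
proof (rule DERIV_pos_imp_increasing[OF assms(2)])
  fix x assume x: "g \<le> x" "x \<le> h"
  have "0 < pi / (2 * sqrt (1 + x / 2))" using assms x by (intro divide_pos_pos) auto
  also have "\<dots> \<le> gauss_int (sqrt (1 + x / 2)) 1"
    using assms x by (intro gauss_int_bounds(1)) auto
  finally have "0 < 2 / pi * gauss_int (sqrt (1 + x / 2)) 1" by simp
  then show "\<exists>y. (pend_J has_real_derivative y) (at x) \<and> 0 < y"
    using pend_J_deriv[of x] assms x by auto
qed

lemma energy_covers:
  assumes "0 < y" "y < 1" "0 < h" "h < energy y"
  obtains x where "0 < x" "x < y" "energy x = h"
proof -
  have "isCont energy x" if "0 \<le> x" "x \<le> y" for x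
  proof -
    have x: "\<bar>x\<bar> < 1" using that assms by auto
    have "agm_b x \<noteq> 0"
      using agm_order(1)[of x] that assms by (cases "x = 0") (auto simp: agm_b_def theta_0)
    then show ?thesis
      unfolding energy_def[abs_def]
      by (intro isCont_divide isCont_mult isCont_diff isCont_power continuous_const
          DERIV_isCont[OF agm_deriv(1)[OF x]] DERIV_isCont[OF agm_deriv(2)[OF x]]) simp
  qed
  moreover have "energy 0 = 0" by (simp add: energy_def agm_a_def agm_b_def)
  ultimately obtain x where x: "0 \<le> x" "x \<le> y" "energy x = h"
    using IVT[of energy 0 h y] assms by auto
  then have "x \<noteq> 0" "x \<noteq> y" using \<open>energy 0 = 0\<close> assms by auto
  with x show ?thesis by (intro that) auto
qed

section \<open>Inversion\<close>

definition J_theta :: "complex \<Rightarrow> complex" where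
  "J_theta q = - 16 * q * deriv theta4 q / theta4 q ^ 3"

lemma J_theta_energy:
  assumes "0 < x" "x < 1"
  shows "J_theta (of_real x) = of_real (pend_J (energy x))"
  using theta4_of_real[of x] deriv_theta4_of_real[of x] assms
  by (simp add: J_theta_def pend_J_energy)

lemma theta4_nonzero_nhds: "\<forall>\<^sub>F q in nhds 0. norm q < 1 \<and> theta4 q \<noteq> 0"
proof -
  have "isCont theta4 0"
    using theta4_holomorphic by (intro continuous_on_interior[of "ball 0 1"] holomorphic_on_imp_continuous_on) auto
  then have "(theta4 \<longlongrightarrow> theta4 0) (nhds 0)"
    by (simp add: continuous_at tendsto_nhds_iff)
  then have "\<forall>\<^sub>F q in nhds 0. theta4 q \<noteq> 0"
    by (rule tendsto_imp_eventually_ne) (simp add: theta4_0)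
  moreover have "\<forall>\<^sub>F q in nhds 0. q \<in> ball (0::complex) 1"
    by (intro eventually_nhds_in_open) auto
  ultimately show ?thesis by eventually_elim auto
qed

lemma J_theta_eq_deriv: "\<forall>\<^sub>F q in nhds 0. J_theta q = 8 * q * deriv (\<lambda>z. 1 / theta4 z ^ 2) q"
  using theta4_nonzero_nhds
proof eventually_elim
  case (elim q)
  have "(theta4 has_field_derivative deriv theta4 q) (at q)"
    by (rule holomorphic_derivI[OF theta4_holomorphic]) (use elim in auto)
  then have "((\<lambda>z. 1 / theta4 z ^ 2) has_field_derivative - (2 * deriv theta4 q) / theta4 q ^ 3) (at q)"
    using elim by (auto intro!: derivative_eq_intros simp: power2_eq_square power3_eq_cube)
  then show ?case
    by (simp add: J_theta_def DERIV_imp_deriv)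
qed

definition J_theta_fps :: "complex fps" where
  "J_theta_fps = fps_const (-16) * fps_X * fps_deriv theta4_fps / theta4_fps ^ 3"

lemma J_theta_has_fps_expansion: "J_theta has_fps_expansion J_theta_fps"
  unfolding J_theta_def[abs_def] J_theta_fps_def
  by (intro fps_expansion_intros theta4_has_fps_expansion) (simp add: theta4_fps_nth)

text \<open>The coefficients are determined successively by comparing coefficients in
  \<open>J \<theta>\<^sub>4\<^sup>3 = - 16 q \<theta>\<^sub>4'\<close>.\<close>

lemma J_theta_fps_nth:
  "fps_nth J_theta_fps 0 = 0" "fps_nth J_theta_fps 1 = 32" "fps_nth J_theta_fps 2 = 192"
  "fps_nth J_theta_fps 3 = 768" "fps_nth J_theta_fps 4 = 2432"
proof -
  have "J_theta_fps * theta4_fps ^ 3 = fps_const (-16) * fps_X * fps_deriv theta4_fps"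
    unfolding J_theta_fps_def
    by (subst fps_divide_unit) (simp_all add: theta4_fps_nth mult.assoc inverse_mult_eq_1)
  then have rec: "fps_nth (J_theta_fps * (theta4_fps * (theta4_fps * theta4_fps))) n
      = fps_nth (fps_X * (fps_const (-16) * fps_deriv theta4_fps)) n" for n
    by (simp add: power3_eq_cube mult_ac)
  note simps = fps_mult_nth sum.atLeast0_atMost_Suc eval_nat_numeral
  show 0: "fps_nth J_theta_fps 0 = 0"
    using rec[of 0] theta4_fps_nth by (simp add: simps)
  show 1: "fps_nth J_theta_fps 1 = 32"
    using rec[of 1] theta4_fps_nth 0 by (simp add: simps)
  show 2: "fps_nth J_theta_fps 2 = 192"
    using rec[of 2] theta4_fps_nth 0 1 by (simp add: simps)
  show 3: "fps_nth J_theta_fps 3 = 768"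
    using rec[of 3] theta4_fps_nth 0 1 2 by (simp add: simps)
  show "fps_nth J_theta_fps 4 = 2432"
    using rec[of 4] theta4_fps_nth 0 1 2 3 by (simp add: simps)
qed


lemma pend_J_bounds:
  assumes "h > 0"
  shows "0 < pend_J h" "pend_J h \<le> 2 * h"
proof -
  have b: "0 \<le> pend_J g" "pend_J g \<le> 2 * g" if "g > 0" for g
  proof -
    have e: "(1::real) \<le> sqrt (1 + g / 2)" using that by simp
    show "0 \<le> pend_J g"
      unfolding pend_J_eq[OF that] using gauss_int_bounds(3)[OF zero_less_one e] that by simp
    have "4 * g / pi * gauss_sin_int (sqrt (1 + g / 2)) 1 \<le> 4 * g / pi * (pi / (2 * 1))"
      by (rule mult_left_mono[OF gauss_int_bounds(4)[OF zero_less_one e]]) (use that in auto)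
    then show "pend_J g \<le> 2 * g"
      unfolding pend_J_eq[OF that] by simp
  qed
  have "0 \<le> pend_J (h / 2)" using b assms by simp
  also have "\<dots> < pend_J h" using assms by (intro pend_J_strict_mono) auto
  finally show "0 < pend_J h" .
  show "pend_J h \<le> 2 * h" using b assms by simp
qed

text \<open>The values \<open>pend_J h\<close> accumulate at \<open>0\<close> because \<open>0 < pend_J h \<le> 2 h\<close>, so the identity
  theorem applies.\<close>

lemma is_q_series_unique:
  assumes "is_q_series P" "is_q_series Q"
  shows "P = Q"
proof -
  obtain e1 where e1: "e1 > 0" "\<And>h. h > 0 \<Longrightarrow> 0 < pend_J h \<Longrightarrow> pend_J h < e1 \<Longrightarrow>
      eval_fps P (of_real (pend_J h)) = of_real (exp (- 2 * pi * pend_dI_dJ h))"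
    and P: "fps_conv_radius P > 0"
    using assms(1) unfolding is_q_series_def by auto
  obtain e2 where e2: "e2 > 0" "\<And>h. h > 0 \<Longrightarrow> 0 < pend_J h \<Longrightarrow> pend_J h < e2 \<Longrightarrow>
      eval_fps Q (of_real (pend_J h)) = of_real (exp (- 2 * pi * pend_dI_dJ h))"
    and Q: "fps_conv_radius Q > 0"
    using assms(2) unfolding is_q_series_def by auto
  obtain s1 where s1: "open s1" "0 \<in> s1" "eval_fps P holomorphic_on s1"
    using has_fps_expansion_imp_holomorphic[OF eval_fps_has_fps_expansion[OF P]] by metis
  obtain s2 where s2: "open s2" "0 \<in> s2" "eval_fps Q holomorphic_on s2"
    using has_fps_expansion_imp_holomorphic[OF eval_fps_has_fps_expansion[OF Q]] by metis
  have "open (s1 \<inter> s2)" "0 \<in> s1 \<inter> s2" using s1 s2 by auto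
  then obtain r where r: "r > 0" "ball 0 r \<subseteq> s1 \<inter> s2"
    using open_contains_ball by metis
  define U where "U = (\<lambda>h. complex_of_real (pend_J h)) ` {h. h > 0 \<and> pend_J h < min r (min e1 e2)}"
  have "(0::complex) islimpt U"
    unfolding islimpt_approachable
  proof (intro allI impI)
    fix e :: real assume "e > 0"
    define h where "h = min e (min r (min e1 e2)) / 4"
    have h: "h > 0" using \<open>e > 0\<close> r e1(1) e2(1) by (simp add: h_def)
    have "pend_J h < min e (min r (min e1 e2))"
      using pend_J_bounds(2)[OF h] h unfolding h_def by linarith
    then show "\<exists>x'\<in>U. x' \<noteq> 0 \<and> dist x' 0 < e"
      using pend_J_bounds(1)[OF h] h
      by (intro bexI[of _ "complex_of_real (pend_J h)"]) (auto simp: U_def)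
  qed
  have "eval_fps P z - eval_fps Q z = 0" if "z \<in> ball 0 r" for z
  proof (rule analytic_continuation[where S = "ball 0 r" and U = U and \<xi> = 0
        and f = "\<lambda>z. eval_fps P z - eval_fps Q z"])
    show "(\<lambda>z. eval_fps P z - eval_fps Q z) holomorphic_on ball 0 r"
      by (intro holomorphic_on_diff holomorphic_on_subset[OF s1(3)] holomorphic_on_subset[OF s2(3)])
         (use r in auto)
    show "U \<subseteq> ball 0 r" by (auto simp: U_def abs_of_pos[OF pend_J_bounds(1)])
    show "0 islimpt U" by fact
    show "eval_fps P z - eval_fps Q z = 0" if "z \<in> U" for z
      using that e1(2) e2(2) pend_J_bounds(1) by (auto simp: U_def)
  qed (use r that in auto)
  then have "\<forall>\<^sub>F z in nhds 0. eval_fps P z = eval_fps Q z"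
    using r(1) unfolding eventually_nhds_metric by (auto simp: dist_norm intro!: exI[of _ r])
  with P Q show ?thesis by (rule eval_fps_eqD)
qed

text \<open>\<open>J_theta\<close> has derivative \<open>32\<close> at \<open>0\<close> and hence a local holomorphic inverse. That its power
  series represents \<open>exp (- 2 pi dI / dJ)\<close> follows by parametrizing the small energies as
  \<open>energy x\<close>; the monotonicity of \<open>pend_J\<close> is used to turn smallness of \<open>pend_J h\<close> into smallness
  of \<open>h\<close>.\<close>

lemma q_series_exists:
  obtains Q where "is_q_series Q" "fps_nth Q 0 = 0" "fps_nth Q 1 = 1 / 32"
    "inverse_near_0 (eval_fps Q) J_theta"
proof -
  obtain s where s: "open s" "0 \<in> s" "J_theta holomorphic_on s"
    using has_fps_expansion_imp_holomorphic[OF J_theta_has_fps_expansion] by metis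
  have dJ: "deriv J_theta 0 = 32"
    using fps_nth_fps_expansion[OF J_theta_has_fps_expansion, of 1] J_theta_fps_nth(2) by simp
  obtain r where r: "r > 0" "ball 0 r \<subseteq> s" "inj_on J_theta (ball 0 r)"
    using has_complex_derivative_locally_injective[OF s(3,2,1)] dJ by auto
  have holo: "J_theta holomorphic_on ball 0 r"
    using s(3) r(2) by (rule holomorphic_on_subset)
  obtain g where g: "g holomorphic_on J_theta ` ball 0 r"
    "\<And>z. z \<in> ball 0 r \<Longrightarrow> deriv J_theta z * deriv g (J_theta z) = 1"
    "\<And>z. z \<in> ball 0 r \<Longrightarrow> g (J_theta z) = z"
    using holomorphic_has_inverse[OF holo open_ball r(3)] by metis
  have J0: "J_theta 0 = 0" by (simp add: J_theta_def)
  define V where "V = J_theta ` ball 0 r"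
  have V: "open V" "0 \<in> V"
    unfolding V_def using open_mapping_thm3[OF holo open_ball r(3)] r(1) J0 by (auto simp: image_iff intro!: bexI[of _ 0])
  define Q where "Q = fps_expansion g 0"
  have gQ: "g has_fps_expansion Q"
    unfolding Q_def by (rule has_fps_expansion_fps_expansion[OF V]) (use g(1) in \<open>simp add: V_def\<close>)
  then have Q: "fps_conv_radius Q > 0" "\<forall>\<^sub>F z in nhds 0. eval_fps Q z = g z"
    by (auto simp: has_fps_expansion_def)
  have g0: "g 0 = 0" using g(3)[of 0] r(1) J0 by simp
  have Q0: "eval_fps Q 0 = 0" using eventually_nhds_x_imp_x[OF Q(2)] g0 by simp
  have contJ: "isCont J_theta 0"
    by (rule has_fps_expansion_imp_continuous[OF J_theta_has_fps_expansion])
  have contQ: "isCont (eval_fps Q) 0"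
    by (rule has_fps_expansion_imp_continuous[OF eval_fps_has_fps_expansion[OF Q(1)]])

  have "is_q_series Q"
  proof -
    obtain e1 where e1: "e1 > 0" "\<And>z. norm z < e1 \<Longrightarrow> eval_fps Q z = g z"
      using Q(2) unfolding eventually_nhds_metric by (auto simp: dist_norm)
    define y where "y = min r 1 / 2"
    have y: "0 < y" "y < 1" "y < r" using r(1) by (auto simp: y_def)
    have Ey: "energy y > 0" by (rule energy_pos[OF y(1,2)])
    have "eval_fps Q (of_real (pend_J h)) = of_real (exp (- 2 * pi * pend_dI_dJ h))"
      if h: "h > 0" "pend_J h < min e1 (pend_J (energy y))" for h
    proof -
      have "h < energy y"
      proof (rule ccontr)
        assume "\<not> h < energy y"
        then have "pend_J (energy y) \<le> pend_J h"
          using pend_J_strict_mono[OF Ey, of h] by (cases "h = energy y") auto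
        with h show False by simp
      qed
      then obtain x where x: "0 < x" "x < y" "energy x = h"
        using energy_covers[OF y(1,2) h(1)] by metis
      have x1: "x < 1" using x y by simp
      have "eval_fps Q (of_real (pend_J h)) = g (J_theta (of_real x))"
        using e1(2)[of "of_real (pend_J h)"] h pend_J_bounds(1)[OF h(1)] J_theta_energy[OF x(1) x1]
        by (simp add: x(3))
      also have "\<dots> = of_real x" using x y by (intro g(3)) auto
      also have "\<dots> = of_real (exp (- 2 * pi * pend_dI_dJ h))"
        using pend_dI_dJ_energy[OF x(1) x1] by (simp add: x(3))
      finally show ?thesis .
    qed
    moreover have "min e1 (pend_J (energy y)) > 0"
      using e1(1) pend_J_bounds(1)[OF Ey] by simp
    ultimately show ?thesis
      unfolding is_q_series_def using Q(1) by (auto intro!: exI[of _ "min e1 (pend_J (energy y))"])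
  qed
  moreover have "fps_nth Q 0 = 0" using Q0 by (simp add: eval_fps_at_0)
  moreover have "fps_nth Q 1 = 1 / 32"
  proof -
    have "fps_nth Q 1 = deriv g 0"
      using fps_nth_fps_expansion[OF gQ, of 1] by simp
    moreover have "32 * deriv g 0 = 1"
      using g(2)[of 0] r(1) by (simp add: dJ J0)
    ultimately show ?thesis by (simp add: field_simps)
  qed
  moreover have "inverse_near_0 (eval_fps Q) J_theta"
    unfolding inverse_near_0_def
  proof (intro conjI Q0 J0 contQ contJ)
    have "\<forall>\<^sub>F z in nhds 0. z \<in> V" by (rule eventually_nhds_in_open[OF V])
    with Q(2) show "\<forall>\<^sub>F z in nhds 0. J_theta (eval_fps Q z) = z"
      by eventually_elim (auto simp: V_def g(3))
    have "filterlim J_theta (nhds 0) (nhds 0)"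
      using contJ by (simp add: continuous_at tendsto_nhds_iff J0)
    then have "\<forall>\<^sub>F w in nhds 0. eval_fps Q (J_theta w) = g (J_theta w)"
      using Q(2) by (rule eventually_compose_filterlim[rotated])
    moreover have "\<forall>\<^sub>F w in nhds 0. w \<in> ball (0::complex) r"
      by (rule eventually_nhds_in_open) (use r in auto)
    ultimately show "\<forall>\<^sub>F w in nhds 0. eval_fps Q (J_theta w) = w"
      by eventually_elim (simp add: g(3))
  qed
  ultimately show ?thesis by (rule that)
qed

theorem mainTheorem6:
  "(\<exists>!Q. is_q_series Q) \<and>
   (\<forall>Q. is_q_series Q \<longrightarrow>
      fps_nth Q 0 = 0 \<and> fps_nth Q 1 = 1 / 32 \<and>
      (\<exists>J :: complex \<Rightarrow> complex.
         inverse_near_0 (eval_fps Q) J \<and>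
         (\<forall>\<^sub>F q in nhds 0. J q = - 16 * q * deriv theta4 q / theta4 q ^ 3) \<and>
         (\<forall>\<^sub>F q in nhds 0. J q = 8 * q * deriv (\<lambda>z. 1 / theta4 z ^ 2) q) \<and>
         (\<exists>F. J has_fps_expansion F \<and>
            fps_nth F 0 = 0 \<and> fps_nth F 1 = 32 * 1 \<and> fps_nth F 2 = 32 * 6 \<and>
            fps_nth F 3 = 32 * 24 \<and> fps_nth F 4 = 32 * 76)))"
proof -
  obtain Q where Q: "is_q_series Q" "fps_nth Q 0 = 0" "fps_nth Q 1 = 1 / 32"
    "inverse_near_0 (eval_fps Q) J_theta"
    by (rule q_series_exists)
  have unique: "P = Q" if "is_q_series P" for P
    by (rule is_q_series_unique[OF that Q(1)])
  have "\<exists>F. J_theta has_fps_expansion F \<and>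
      fps_nth F 0 = 0 \<and> fps_nth F 1 = 32 * 1 \<and> fps_nth F 2 = 32 * 6 \<and>
      fps_nth F 3 = 32 * 24 \<and> fps_nth F 4 = 32 * 76"
    using J_theta_has_fps_expansion J_theta_fps_nth by (intro exI[of _ J_theta_fps]) simp
  then have "\<exists>J :: complex \<Rightarrow> complex.
         inverse_near_0 (eval_fps Q) J \<and>
         (\<forall>\<^sub>F q in nhds 0. J q = - 16 * q * deriv theta4 q / theta4 q ^ 3) \<and>
         (\<forall>\<^sub>F q in nhds 0. J q = 8 * q * deriv (\<lambda>z. 1 / theta4 z ^ 2) q) \<and>
         (\<exists>F. J has_fps_expansion F \<and>
            fps_nth F 0 = 0 \<and> fps_nth F 1 = 32 * 1 \<and> fps_nth F 2 = 32 * 6 \<and>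
            fps_nth F 3 = 32 * 24 \<and> fps_nth F 4 = 32 * 76)"
    using Q(4) J_theta_eq_deriv by (intro exI[of _ J_theta]) (simp add: J_theta_def)
  with Q unique show ?thesis by blast
qed

end
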